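(* Let $k$ be an algebraically closed field of characteristic zero, $\mathfrak{g}$ a finite-dimensional simple Lie algebra over $k$ with a fixed Cartan subalgebra $\mathfrak{h}$, $S$ a commutative, associative, unital $k$-algebra of finite type, and $\mathcal{L}=\mathfrak{g}\otimes_k S$. Let $V$ be a simple admissible module of $\mathcal{L}$. Then $I=I(V)$ is a radical ideal of $S$.
   Context: The Lie bracket on $\mathcal{L}=\mathfrak{g}\otimes S$ is $[x\otimes r,y\otimes s]=[x,y]\otimes rs$. An $\mathcal{L}$-module $V$ is a weight module if $V=\bigoplus_{\lambda\in\mathfrak{h}^*}V_\lambda$ with each weight space $V_\lambda=\{v\in V\mid (h\otimes 1)v=\lambda(h)v\text{ for all }h\in\mathfrak{h}\}$ finite dimensional. A weight module is admissible if there is $B\in\mathbb{Z}_{>0}$ with $\dim V_\lambda\le B$ for all $\lambda$. Every ideal of $\mathcal{L}$ is of the form $\mathfrak{g}\otimes P$ for an ideal $P$ of $S$; if $\phi:\mathcal{L}\to\operatorname{End}V$ is the module action, $I(V)$ is the ideal of $S$ with $\ker\phi=\mathfrak{g}\otimes I(V)$. An ideal $I$ is radical if $\sqrt{I}=I$ (so the unit ideal $S$ counts as radical). *)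

theory Defs
  imports
    "HOL-Library.FuncSet"
    "HOL-Library.Poly_Mapping"
    "HOL-Computational_Algebra.Polynomial"
begin

section \<open>Vector spaces\<close>

text \<open>
  \<^const>\<open>vector_space.dim\<close> is a natural number, equal to \<open>0\<close> for infinite-dimensional
  subspaces, so finite-dimensionality is always required separately.
\<close>

definition fin_dim :: "('k::field \<Rightarrow> 'v::ab_group_add \<Rightarrow> 'v) \<Rightarrow> 'v set \<Rightarrow> bool" where
  "fin_dim scale W \<longleftrightarrow> (\<exists>A. finite A \<and> module.span scale A = W)"

definition direct_sum_decomp :: "'i set \<Rightarrow> ('i \<Rightarrow> 'v::comm_monoid_add set) \<Rightarrow> bool" where
  "direct_sum_decomp J W \<longleftrightarrow>
     (\<forall>v. \<exists>!f. (\<forall>i\<in>J. f i \<in> W i) \<and> (\<forall>i. i \<notin> J \<longrightarrow> f i = 0) \<and>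
              finite {i. f i \<noteq> 0} \<and> v = (\<Sum>i | f i \<noteq> 0. f i))"

text \<open>
  The dual of a subspace \<open>H\<close>. Functionals are normalised to be \<^const>\<open>undefined\<close> outside \<open>H\<close>,
  so that distinct elements are distinct functionals on \<open>H\<close>.
\<close>

definition dual_of :: "('k::field \<Rightarrow> 'v::ab_group_add \<Rightarrow> 'v) \<Rightarrow> 'v set \<Rightarrow> ('v \<Rightarrow> 'k) set" where
  "dual_of scale H =
     {l \<in> extensional H. (\<forall>x\<in>H. \<forall>y\<in>H. l (x + y) = l x + l y) \<and>
                         (\<forall>c. \<forall>x\<in>H. l (scale c x) = c * l x)}"

section \<open>Lie algebras\<close>

locale lie_algebra = vector_space scale
  for scale :: "'k::field \<Rightarrow> 'g::ab_group_add \<Rightarrow> 'g" +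
  fixes br :: "'g \<Rightarrow> 'g \<Rightarrow> 'g"
  assumes br_add_left: "br (x + y) z = br x z + br y z"
    and br_add_right: "br x (y + z) = br x y + br x z"
    and br_scale_left: "br (scale c x) y = scale c (br x y)"
    and br_scale_right: "br x (scale c y) = scale c (br x y)"
    and br_self: "br x x = 0"
    and jacobi: "br x (br y z) + br y (br z x) + br z (br x y) = 0"
begin

definition lie_subalgebra :: "'g set \<Rightarrow> bool" where
  "lie_subalgebra H \<longleftrightarrow> subspace H \<and> (\<forall>x\<in>H. \<forall>y\<in>H. br x y \<in> H)"

definition lie_ideal :: "'g set \<Rightarrow> bool" where
  "lie_ideal J \<longleftrightarrow> subspace J \<and> (\<forall>x. \<forall>y\<in>J. br x y \<in> J)"

definition simple :: bool where
  "simple \<longleftrightarrow> (\<exists>x y. br x y \<noteq> 0) \<and> (\<forall>J. lie_ideal J \<longrightarrow> J = {0} \<or> J = UNIV)"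

primrec lower_central :: "'g set \<Rightarrow> nat \<Rightarrow> 'g set" where
  "lower_central H 0 = H"
| "lower_central H (Suc n) = span {br x y | x y. x \<in> H \<and> y \<in> lower_central H n}"

definition normalizer :: "'g set \<Rightarrow> 'g set" where
  "normalizer H = {x. \<forall>y\<in>H. br x y \<in> H}"

definition cartan_subalgebra :: "'g set \<Rightarrow> bool" where
  "cartan_subalgebra H \<longleftrightarrow>
     lie_subalgebra H \<and> (\<exists>n. lower_central H n = {0}) \<and> normalizer H = H"

end

section \<open>Commutative unital algebras\<close>

text \<open>
  The unit \<open>e\<close> is explicit because the type class \<^class>\<open>comm_ring_1\<close> requires \<open>0 \<noteq> 1\<close> and
  would exclude the zero algebra.
\<close>

locale unital_comm_algebra = vector_space scale
  for scale :: "'k::field \<Rightarrow> 's::comm_ring \<Rightarrow> 's" +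
  fixes e :: 's
  assumes unit_mult: "e * r = r"
    and scale_mult_left: "scale c r * s = scale c (r * s)"
begin

definition subalgebra :: "'s set \<Rightarrow> bool" where
  "subalgebra T \<longleftrightarrow> subspace T \<and> e \<in> T \<and> (\<forall>r\<in>T. \<forall>s\<in>T. r * s \<in> T)"

definition finite_type :: bool where
  "finite_type \<longleftrightarrow> (\<exists>F. finite F \<and> subalgebra hull F = UNIV)"

definition ring_ideal :: "'s set \<Rightarrow> bool" where
  "ring_ideal P \<longleftrightarrow> 0 \<in> P \<and> (\<forall>p\<in>P. \<forall>q\<in>P. p + q \<in> P) \<and> (\<forall>r. \<forall>p\<in>P. r * p \<in> P)"

definition pow :: "'s \<Rightarrow> nat \<Rightarrow> 's" where
  "pow s n = ((*) s ^^ n) e"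

definition rad :: "'s set \<Rightarrow> 's set" where
  "rad P = {s. \<exists>n. pow s n \<in> P}"

definition radical_ideal :: "'s set \<Rightarrow> bool" where
  "radical_ideal P \<longleftrightarrow> ring_ideal P \<and> rad P = P"

end

section \<open>The free vector space on a set\<close>

definition free_scale :: "'k::field \<Rightarrow> ('a \<Rightarrow>\<^sub>0 'k) \<Rightarrow> 'a \<Rightarrow>\<^sub>0 'k" where
  "free_scale c = Poly_Mapping.map ((*) c)"

lemma lookup_free_scale [simp]:
  "Poly_Mapping.lookup (free_scale c f) x = c * Poly_Mapping.lookup f x"
  by (simp add: free_scale_def Poly_Mapping.map.rep_eq when_def)

interpretation free: vector_space "free_scale :: 'k::field \<Rightarrow> ('a \<Rightarrow>\<^sub>0 'k) \<Rightarrow> _"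
  by unfold_locales (auto intro!: poly_mapping_eqI simp: lookup_add algebra_simps)

lemma free_scale_single [simp]:
  "free_scale c (Poly_Mapping.single x a) = Poly_Mapping.single x (c * a)"
  by (rule poly_mapping_eqI) (simp add: lookup_single when_def)

section \<open>The Lie algebra \<open>\<gg> \<otimes> S\<close>\<close>

text \<open>
  The tensor product is the quotient of the free vector space on \<open>'g \<times> 's\<close> by the subspace
  spanned by the bilinearity relations; its elements are cosets.
\<close>

type_synonym ('g, 's, 'k) tensor = "('g \<times> 's \<Rightarrow>\<^sub>0 'k) set"

locale current_algebra =
  G: lie_algebra scaleG br + S: unital_comm_algebra scaleS e
  for scaleG :: "'k::field \<Rightarrow> 'g::ab_group_add \<Rightarrow> 'g"
    and br :: "'g \<Rightarrow> 'g \<Rightarrow> 'g"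
    and scaleS :: "'k \<Rightarrow> 's::comm_ring \<Rightarrow> 's"
    and e :: 's
begin

definition relators :: "('g \<times> 's \<Rightarrow>\<^sub>0 'k) set" where
  "relators =
     {Poly_Mapping.single (x + y, s) 1 - Poly_Mapping.single (x, s) 1
        - Poly_Mapping.single (y, s) 1 | x y s. True} \<union>
     {Poly_Mapping.single (x, r + s) 1 - Poly_Mapping.single (x, r) 1
        - Poly_Mapping.single (x, s) 1 | x r s. True} \<union>
     {Poly_Mapping.single (scaleG c x, s) 1 - Poly_Mapping.single (x, s) c | c x s. True} \<union>
     {Poly_Mapping.single (x, scaleS c s) 1 - Poly_Mapping.single (x, s) c | c x s. True}"

definition tensor_rel :: "(('g \<times> 's \<Rightarrow>\<^sub>0 'k) \<times> ('g \<times> 's \<Rightarrow>\<^sub>0 'k)) set" where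
  "tensor_rel = {(f, g). f - g \<in> free.span relators}"

definition cls :: "('g \<times> 's \<Rightarrow>\<^sub>0 'k) \<Rightarrow> ('g, 's, 'k) tensor" where
  "cls f = tensor_rel `` {f}"

definition tensor_space :: "('g, 's, 'k) tensor set" where
  "tensor_space = UNIV // tensor_rel"

definition pure :: "'g \<Rightarrow> 's \<Rightarrow> ('g, 's, 'k) tensor" where
  "pure x s = cls (Poly_Mapping.single (x, s) 1)"

text \<open>
  The operations on cosets are the usual descents from representatives: the union below is
  a single coset, see \<open>tensor_add_cls\<close>, \<open>tensor_scale_cls\<close> and \<open>tensor_bracket_cls\<close>.
\<close>

definition tensor_add ::
    "('g, 's, 'k) tensor \<Rightarrow> ('g, 's, 'k) tensor \<Rightarrow> ('g, 's, 'k) tensor" where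
  "tensor_add A B = (\<Union>f\<in>A. \<Union>g\<in>B. cls (f + g))"

definition tensor_scale :: "'k \<Rightarrow> ('g, 's, 'k) tensor \<Rightarrow> ('g, 's, 'k) tensor" where
  "tensor_scale c A = (\<Union>f\<in>A. cls (free_scale c f))"

definition free_bracket ::
    "('g \<times> 's \<Rightarrow>\<^sub>0 'k) \<Rightarrow> ('g \<times> 's \<Rightarrow>\<^sub>0 'k) \<Rightarrow> ('g \<times> 's \<Rightarrow>\<^sub>0 'k)" where
  "free_bracket f g =
     (\<Sum>p\<in>Poly_Mapping.keys f. \<Sum>q\<in>Poly_Mapping.keys g.
        Poly_Mapping.single (br (fst p) (fst q), snd p * snd q)
          (Poly_Mapping.lookup f p * Poly_Mapping.lookup g q))"

definition tensor_bracket ::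
    "('g, 's, 'k) tensor \<Rightarrow> ('g, 's, 'k) tensor \<Rightarrow> ('g, 's, 'k) tensor" where
  "tensor_bracket A B = (\<Union>f\<in>A. \<Union>g\<in>B. cls (free_bracket f g))"

text \<open>The subspace \<open>\<gg> \<otimes> P\<close> of \<open>\<gg> \<otimes> S\<close>, i.e. all finite sums of \<open>x \<otimes> p\<close> with \<open>p \<in> P\<close>.\<close>

definition tensor_sub :: "'s set \<Rightarrow> ('g, 's, 'k) tensor set" where
  "tensor_sub P = {cls f | f. Poly_Mapping.keys f \<subseteq> UNIV \<times> P}"

subsection \<open>Well-definedness of the operations\<close>

lemma equiv_tensor_rel: "equiv UNIV tensor_rel"
proof (rule equivI)
  show "refl tensor_rel"
    by (auto simp: refl_on_def tensor_rel_def free.span_zero)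
  show "sym tensor_rel"
  proof (rule symI)
    fix f g assume "(f, g) \<in> tensor_rel"
    hence "- (f - g) \<in> free.span relators"
      unfolding tensor_rel_def by (blast intro: free.span_neg)
    thus "(g, f) \<in> tensor_rel" by (simp add: tensor_rel_def)
  qed
  show "trans tensor_rel"
  proof (rule transI)
    fix f g h assume "(f, g) \<in> tensor_rel" "(g, h) \<in> tensor_rel"
    hence "(f - g) + (g - h) \<in> free.span relators"
      unfolding tensor_rel_def by (blast intro: free.span_add)
    thus "(f, h) \<in> tensor_rel" by (simp add: tensor_rel_def)
  qed
qed auto

lemma cls_eq_iff: "cls f = cls g \<longleftrightarrow> f - g \<in> free.span relators"
  unfolding cls_def using eq_equiv_class_iff[OF equiv_tensor_rel, of f g]
  by (simp add: tensor_rel_def)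

lemma tensor_add_cls: "tensor_add (cls f) (cls g) = cls (f + g)"
proof -
  have "congruent2 tensor_rel tensor_rel (\<lambda>f g. cls (f + g))"
  proof (rule congruent2I')
    fix f f' g g' assume "(f, f') \<in> tensor_rel" "(g, g') \<in> tensor_rel"
    hence "(f - f') + (g - g') \<in> free.span relators"
      unfolding tensor_rel_def by (auto intro: free.span_add)
    thus "cls (f + g) = cls (f' + g')" by (simp add: cls_eq_iff algebra_simps)
  qed
  from UN_equiv_class2[OF equiv_tensor_rel equiv_tensor_rel this, of f g]
  show ?thesis by (simp add: tensor_add_def flip: cls_def)
qed

lemma tensor_scale_cls: "tensor_scale c (cls f) = cls (free_scale c f)"
proof -
  have "congruent tensor_rel (\<lambda>f. cls (free_scale c f))"
  proof (rule congruentI)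
    fix f f' assume "(f, f') \<in> tensor_rel"
    hence "free_scale c (f - f') \<in> free.span relators"
      unfolding tensor_rel_def by (auto intro: free.span_scale)
    thus "cls (free_scale c f) = cls (free_scale c f')"
      by (simp add: cls_eq_iff free.scale_right_diff_distrib)
  qed
  from UN_equiv_class[OF equiv_tensor_rel this, of f]
  show ?thesis by (simp add: tensor_scale_def flip: cls_def)
qed

lemma free_bracket_superset:
  assumes "finite A" "finite B" "Poly_Mapping.keys f \<subseteq> A" "Poly_Mapping.keys g \<subseteq> B"
  shows "free_bracket f g =
     (\<Sum>p\<in>A. \<Sum>q\<in>B.
        Poly_Mapping.single (br (fst p) (fst q), snd p * snd q)
          (Poly_Mapping.lookup f p * Poly_Mapping.lookup g q))"
proof -
  have "free_bracket f g = (\<Sum>p\<in>Poly_Mapping.keys f. \<Sum>q\<in>B.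
        Poly_Mapping.single (br (fst p) (fst q), snd p * snd q)
          (Poly_Mapping.lookup f p * Poly_Mapping.lookup g q))"
    unfolding free_bracket_def
    by (intro sum.cong refl sum.mono_neutral_left) (use assms in \<open>auto simp: in_keys_iff\<close>)
  also have "\<dots> = (\<Sum>p\<in>A. \<Sum>q\<in>B.
        Poly_Mapping.single (br (fst p) (fst q), snd p * snd q)
          (Poly_Mapping.lookup f p * Poly_Mapping.lookup g q))"
    by (intro sum.mono_neutral_left) (use assms in \<open>auto simp: in_keys_iff\<close>)
  finally show ?thesis .
qed

lemma free_bracket_add_left: "free_bracket (f + f') g = free_bracket f g + free_bracket f' g"
proof -
  let ?A = "Poly_Mapping.keys f \<union> Poly_Mapping.keys f'"
  have "Poly_Mapping.keys (f + f') \<subseteq> ?A" by (rule Poly_Mapping.keys_add)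
  thus ?thesis
    by (simp add: free_bracket_superset[of ?A "Poly_Mapping.keys g"] lookup_add distrib_right single_add
        sum.distrib)
qed

lemma free_bracket_add_right: "free_bracket f (g + g') = free_bracket f g + free_bracket f g'"
proof -
  let ?B = "Poly_Mapping.keys g \<union> Poly_Mapping.keys g'"
  have "Poly_Mapping.keys (g + g') \<subseteq> ?B" by (rule Poly_Mapping.keys_add)
  thus ?thesis
    by (simp add: free_bracket_superset[of "Poly_Mapping.keys f" ?B] lookup_add distrib_left single_add
        sum.distrib)
qed

lemma keys_free_scale: "Poly_Mapping.keys (free_scale c f) \<subseteq> Poly_Mapping.keys f"
  by (auto simp: in_keys_iff)

lemma free_bracket_scale_left: "free_bracket (free_scale c f) g = free_scale c (free_bracket f g)"
  using keys_free_scale[of c f]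
  by (simp add: free_bracket_superset[of "Poly_Mapping.keys f" "Poly_Mapping.keys g"] free.scale_sum_right mult.assoc)

lemma free_bracket_scale_right: "free_bracket f (free_scale c g) = free_scale c (free_bracket f g)"
  using keys_free_scale[of c g]
  by (simp add: free_bracket_superset[of "Poly_Mapping.keys f" "Poly_Mapping.keys g"] free.scale_sum_right ac_simps)

lemma free_bracket_diff_left: "free_bracket (f - f') g = free_bracket f g - free_bracket f' g"
  using free_bracket_add_left[of "f - f'" f' g] by (simp add: algebra_simps)

lemma free_bracket_diff_right: "free_bracket f (g - g') = free_bracket f g - free_bracket f g'"
  using free_bracket_add_right[of f "g - g'" g'] by (simp add: algebra_simps)

lemma free_bracket_single:
  "free_bracket (Poly_Mapping.single (x, r) a) (Poly_Mapping.single (y, s) b) =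
   Poly_Mapping.single (br x y, r * s) (a * b)"
  by (subst free_bracket_superset[of "{(x, r)}" "{(y, s)}"]) auto

lemma span_by_single:
  assumes "\<And>x s. T (Poly_Mapping.single (x, s) 1) \<in> free.span relators"
    and "\<And>f g. T (f + g) = T f + T g" and "\<And>c f. T (free_scale c f) = free_scale c (T f)"
  shows "T f \<in> free.span relators"
proof -
  have T0: "T 0 = 0" using assms(3)[of 0 0] by simp
  have "T (\<Sum>p\<in>A. Poly_Mapping.single p (Poly_Mapping.lookup f p)) \<in> free.span relators"
    if "finite A" for A
    using that
  proof (induction A rule: finite_induct)
    case empty
    show ?case by (simp add: T0 free.span_zero)
  next
    case (insert p A)
    obtain x s where p: "p = (x, s)" by (cases p)
    have "T (Poly_Mapping.single p (Poly_Mapping.lookup f p)) =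
        free_scale (Poly_Mapping.lookup f p) (T (Poly_Mapping.single p 1))"
      by (simp flip: assms(3))
    with insert assms(1)[of x s] show ?case
      by (simp add: p assms(2) free.span_add free.span_scale)
  qed
  moreover have
    "(\<Sum>p\<in>Poly_Mapping.keys f. Poly_Mapping.single p (Poly_Mapping.lookup f p)) = f"
    by (rule poly_mapping_eqI) (auto simp: lookup_sum lookup_single when_def in_keys_iff)
  ultimately show ?thesis
    using finite_keys[of f] by metis
qed

lemma relators_bracket_left:
  assumes "n \<in> relators"
  shows "free_bracket n (Poly_Mapping.single (y, t) 1) \<in> free.span relators"
proof (rule free.span_base)
  have scale_mult: "scaleS c s * t = scaleS c (s * t)" for c s
    by (rule S.scale_mult_left)
  show "free_bracket n (Poly_Mapping.single (y, t) 1) \<in> relators"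
    using assms unfolding relators_def
    by (elim UnE CollectE exE)
       (simp add: free_bracket_diff_left free_bracket_single G.br_add_left G.br_scale_left
          distrib_right scale_mult; blast)+
qed

lemma relators_bracket_right:
  assumes "n \<in> relators"
  shows "free_bracket (Poly_Mapping.single (y, t) 1) n \<in> free.span relators"
proof (rule free.span_base)
  have scale_mult: "t * scaleS c s = scaleS c (t * s)" for c s
    using S.scale_mult_left[of c s t] by (simp add: mult.commute)
  show "free_bracket (Poly_Mapping.single (y, t) 1) n \<in> relators"
    using assms unfolding relators_def
    by (elim UnE CollectE exE)
       (simp add: free_bracket_diff_right free_bracket_single G.br_add_right G.br_scale_right
          distrib_left scale_mult; blast)+
qed

lemma span_relators_bracket_left:
  assumes "n \<in> free.span relators"
  shows "free_bracket n g \<in> free.span relators"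
  using assms
proof (induction rule: free.span_induct_alt)
  case base
  show ?case by (simp add: free_bracket_def free.span_zero)
next
  case (step c n m)
  have "free_bracket n g \<in> free.span relators"
    by (rule span_by_single[where T = "free_bracket n"])
       (simp_all add: relators_bracket_left step free_bracket_add_right free_bracket_scale_right)
  thus ?case using step
    by (simp add: free_bracket_add_left free_bracket_scale_left free.span_add free.span_scale)
qed

lemma span_relators_bracket_right:
  assumes "n \<in> free.span relators"
  shows "free_bracket g n \<in> free.span relators"
  using assms
proof (induction rule: free.span_induct_alt)
  case base
  show ?case by (simp add: free_bracket_def free.span_zero)
next
  case (step c n m)
  have "free_bracket g n \<in> free.span relators"
    by (rule span_by_single[where T = "\<lambda>g. free_bracket g n"])
       (simp_all add: relators_bracket_right step free_bracket_add_left free_bracket_scale_left)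
  thus ?case using step
    by (simp add: free_bracket_add_right free_bracket_scale_right free.span_add free.span_scale)
qed

lemma tensor_bracket_cls: "tensor_bracket (cls f) (cls g) = cls (free_bracket f g)"
proof -
  have "congruent2 tensor_rel tensor_rel (\<lambda>f g. cls (free_bracket f g))"
  proof (rule congruent2I')
    fix f f' g g' assume "(f, f') \<in> tensor_rel" "(g, g') \<in> tensor_rel"
    hence "f - f' \<in> free.span relators" "g - g' \<in> free.span relators"
      by (simp_all add: tensor_rel_def)
    hence "free_bracket (f - f') g + free_bracket f' (g - g') \<in> free.span relators"
      by (intro free.span_add span_relators_bracket_left span_relators_bracket_right)
    thus "cls (free_bracket f g) = cls (free_bracket f' g')"
      by (simp add: cls_eq_iff free_bracket_diff_left free_bracket_diff_right)
  qed
  from UN_equiv_class2[OF equiv_tensor_rel equiv_tensor_rel this, of f g]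
  show ?thesis by (simp add: tensor_bracket_def flip: cls_def)
qed

lemma tensor_bracket_pure: "tensor_bracket (pure x r) (pure y s) = pure (br x y) (r * s)"
  by (simp add: pure_def tensor_bracket_cls free_bracket_single)

end

section \<open>Modules over \<open>\<gg> \<otimes> S\<close>\<close>

text \<open>The values of \<open>\<phi>\<close> outside \<open>tensor_space\<close> are irrelevant.\<close>

locale current_algebra_module =
  current_algebra scaleG br scaleS e + V: vector_space scaleV
  for scaleG :: "'k::field \<Rightarrow> 'g::ab_group_add \<Rightarrow> 'g"
    and br :: "'g \<Rightarrow> 'g \<Rightarrow> 'g"
    and scaleS :: "'k \<Rightarrow> 's::comm_ring \<Rightarrow> 's"
    and e :: 's
    and scaleV :: "'k \<Rightarrow> 'v::ab_group_add \<Rightarrow> 'v" +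
  fixes \<phi> :: "('g, 's, 'k) tensor \<Rightarrow> 'v \<Rightarrow> 'v"
  assumes act_linear: "A \<in> tensor_space \<Longrightarrow> Vector_Spaces.linear scaleV scaleV (\<phi> A)"
    and act_add: "A \<in> tensor_space \<Longrightarrow> B \<in> tensor_space \<Longrightarrow>
      \<phi> (tensor_add A B) v = \<phi> A v + \<phi> B v"
    and act_scale: "A \<in> tensor_space \<Longrightarrow> \<phi> (tensor_scale c A) v = scaleV c (\<phi> A v)"
    and act_bracket: "A \<in> tensor_space \<Longrightarrow> B \<in> tensor_space \<Longrightarrow>
      \<phi> (tensor_bracket A B) v = \<phi> A (\<phi> B v) - \<phi> B (\<phi> A v)"
begin

definition submodule :: "'v set \<Rightarrow> bool" where
  "submodule W \<longleftrightarrow> V.subspace W \<and> (\<forall>A\<in>tensor_space. \<forall>w\<in>W. \<phi> A w \<in> W)"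

definition simple_module :: bool where
  "simple_module \<longleftrightarrow> (\<exists>v::'v. v \<noteq> 0) \<and> (\<forall>W. submodule W \<longrightarrow> W = {0} \<or> W = UNIV)"

definition weight_space :: "'g set \<Rightarrow> ('g \<Rightarrow> 'k) \<Rightarrow> 'v set" where
  "weight_space H l = {v. \<forall>h\<in>H. \<phi> (pure h e) v = scaleV (l h) v}"

definition weight_module :: "'g set \<Rightarrow> bool" where
  "weight_module H \<longleftrightarrow>
     direct_sum_decomp (dual_of scaleG H) (weight_space H) \<and>
     (\<forall>l\<in>dual_of scaleG H. fin_dim scaleV (weight_space H l))"

definition admissible :: "'g set \<Rightarrow> bool" where
  "admissible H \<longleftrightarrow> weight_module H \<and>
     (\<exists>B>0. \<forall>l\<in>dual_of scaleG H. V.dim (weight_space H l) \<le> B)"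

definition act_kernel :: "('g, 's, 'k) tensor set" where
  "act_kernel = {A \<in> tensor_space. \<forall>v. \<phi> A v = 0}"

definition ideal_of_module :: "'s set" where
  "ideal_of_module = (THE P. S.ring_ideal P \<and> act_kernel = tensor_sub P)"

end

end

theory Submission
  imports Defs
begin

text \<open>
  Since \<open>V\<close> is a faithful weight module over \<open>\<gg> \<otimes> e\<close> unless it is trivial, \<open>\<hh>\<close> is abelian and
  \<open>\<gg>\<close> is spanned by \<open>\<hh>\<close>-weight vectors. If \<open>t * t\<close> acts as zero, all operators \<open>x \<otimes> t\<close> commute,
  and \<open>ad (x \<otimes> t)\<close> squares to zero on \<open>\<gg> \<otimes> S\<close>; hence the generalised eigenspaces of \<open>x \<otimes> t\<close> are
  submodules and \<open>x \<otimes> t\<close> has a single eigenvalue on \<open>V\<close>. Bounded multiplicities force this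
  eigenvalue to vanish for root vectors, and finite-dimensionality of the weight spaces then forces
  it to vanish on the brackets of opposite root vectors, thus on all of \<open>\<gg>\<close>. So the commuting operators
  \<open>x \<otimes> t r\<close> are locally nilpotent and have a common null vector. These vectors form a submodule,
  so \<open>t\<close> acts as zero.
\<close>

section \<open>Linear algebra\<close>

text \<open>Squares suffice: once t * t in the annihilator forces t into it, an exponent n \<ge> 2
  can be replaced by half of n, rounded up. Products (t r)(t r') annihilate V along with t * t, so
  all operators x \<otimes> t r commute with each other. Two obstacles shape the rest. A common null
  vector is built one operator at a time, hence for finitely many, while r ranges over all of S;
  finite-dimensional weight spaces help, since on one of them finitely many r determine every x
  \<otimes> t r. And I(V) is given through the kernel in the tensor product, so the ideal of all s
  with g \<otimes> s acting as zero can be identified with it only after that kernel has been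
  computed, by a Schur argument on the adjoint module.\<close>

lemma linear_simps:
  assumes "Vector_Spaces.linear s1 s2 f"
  shows "f (x + y) = f x + f y" "f (s1 c x) = s2 c (f x)" "f 0 = 0"
    "f (x - y) = f x - f y" "f (- x) = - f x" "f (sum g A) = (\<Sum>a\<in>A. f (g a))"
proof -
  interpret module_hom s1 s2 f using assms by (simp add: linear_iff_module_hom)
  show "f (x + y) = f x + f y" "f (s1 c x) = s2 c (f x)" "f 0 = 0"
    "f (x - y) = f x - f y" "f (- x) = - f x" "f (sum g A) = (\<Sum>a\<in>A. f (g a))"
    by (simp_all add: add scale diff neg sum)
qed

context vector_space
begin

lemma linearI:
  assumes "\<And>x y. f (x + y) = f x + f y" "\<And>c x. f (scale c x) = scale c (f x)"
  shows "Vector_Spaces.linear scale scale f"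
  using assms vector_space_axioms by (simp add: Vector_Spaces.linear_iff)

lemma linear_shift:
  assumes "Vector_Spaces.linear scale scale f"
  shows "Vector_Spaces.linear scale scale (\<lambda>v. f v - scale c v)"
proof (rule linearI)
  fix x y a
  show "f (x + y) - scale c (x + y) = f x - scale c x + (f y - scale c y)"
    by (simp add: linear_simps[OF assms] scale_right_distrib)
  show "f (scale a x) - scale c (scale a x) = scale a (f x - scale c x)"
    by (simp add: linear_simps[OF assms] scale_right_diff_distrib mult.commute)
qed

lemma linear_funpow:
  assumes "Vector_Spaces.linear scale scale f"
  shows "Vector_Spaces.linear scale scale (f ^^ n)"
proof (induction n)
  case (Suc n)
  show ?case
    by (rule linearI) (simp_all add: linear_simps[OF assms] linear_simps[OF Suc])
qed (auto intro: linearI)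

lemma independent_chain:
  assumes "\<And>j. j < n \<Longrightarrow> u j \<notin> span (u ` {..<j})"
  shows "independent (u ` {..<n}) \<and> card (u ` {..<n}) = n"
  using assms
proof (induction n)
  case (Suc n)
  have "u n \<notin> span (u ` {..<n})" using Suc.prems by simp
  moreover from this have "u n \<notin> u ` {..<n}" by (rule contrapos_nn) (rule span_base)
  moreover have "independent (u ` {..<n})" "card (u ` {..<n}) = n" using Suc by simp_all
  ultimately show ?case by (simp add: lessThan_Suc independent_insertI)
qed (simp add: independent_empty)

lemma chain_in_span:
  fixes u :: "nat \<Rightarrow> 'b"
  assumes "finite A" "range u \<subseteq> span A"
  obtains j where "u j \<in> span (u ` {..<j})"
proof -
  have "\<exists>j. u j \<in> span (u ` {..<j})"
  proof (rule ccontr)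
    assume "\<nexists>j. u j \<in> span (u ` {..<j})"
    hence "independent (u ` {..<Suc (card A)})" "card (u ` {..<Suc (card A)}) = Suc (card A)"
      using independent_chain[of "Suc (card A)" u] by blast+
    moreover have "u ` {..<Suc (card A)} \<subseteq> span A" using assms(2) by blast
    ultimately show False using independent_span_bound[OF assms(1)] by fastforce
  qed
  thus ?thesis using that by blast
qed

text \<open>
  The \<open>u j\<close> have strictly increasing nilpotency index with respect to \<open>D\<close>, so they are
  linearly independent.
\<close>

lemma no_nilpotent_ladder:
  assumes D: "Vector_Spaces.linear scale scale D"
    and A: "finite A" "range u \<subseteq> span A"
    and u0: "u 0 \<noteq> 0" "D (u 0) = 0"
    and uS: "\<And>j. D (u (Suc j)) = scale (c j) (u j) + scale (d j) (u (j - 1))"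
    and c: "\<And>j. c j \<noteq> 0" and d0: "d 0 = 0"
  shows False
proof -
  note lin = linear_simps[OF linear_funpow[OF D]]
  have step: "(D ^^ Suc k) (u (Suc j)) =
      scale (c j) ((D ^^ k) (u j)) + scale (d j) ((D ^^ k) (u (j - 1)))" for k j
    by (simp add: funpow_Suc_right uS lin del: funpow.simps)
  have van: "(D ^^ k) (u j) = 0" if "j < k" for k j
    using that
  proof (induction k arbitrary: j)
    case (Suc k)
    show ?case
    proof (cases j)
      case 0
      thus ?thesis using u0 by (simp add: funpow_Suc_right lin del: funpow.simps)
    next
      case (Suc i)
      thus ?thesis unfolding \<open>j = Suc i\<close> step using Suc.IH[of i] Suc.IH[of "i - 1"] Suc.prems Suc
        by simp
    qed
  qed simp
  have nonvan: "(D ^^ j) (u j) \<noteq> 0" for j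
  proof (induction j)
    case (Suc j)
    \<comment> \<open>At \<open>j = 0\<close> the truncated index \<open>j - 1\<close> is 0 again,
      where \<open>van\<close> says nothing; \<open>d 0 = 0\<close> removes that term.\<close>
    have "scale (d j) ((D ^^ j) (u (j - 1))) = 0"
      using d0 van[of "j - 1" j] by (cases j) auto
    thus ?case unfolding step using Suc c[of j]
      by (metis add_0_right scale_eq_0_iff)
  qed (use u0 in simp)
  obtain j where j: "u j \<in> span (u ` {..<j})"
    using chain_in_span[OF A] .
  have "span (u ` {..<j}) \<subseteq> {v. (D ^^ j) v = 0}"
    by (rule span_minimal) (auto simp: van intro!: subspaceI simp: lin)
  with j nonvan show False by blast
qed

end

section \<open>Eigenvectors over an algebraically closed field\<close>

locale alg_closed_vector_space = vector_space scale
  for scale :: "'k::alg_closed_field \<Rightarrow> 'v::ab_group_add \<Rightarrow> 'v"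
begin

definition evalp :: "('v \<Rightarrow> 'v) \<Rightarrow> 'k poly \<Rightarrow> 'v \<Rightarrow> 'v" where
  "evalp f p v = (\<Sum>i\<le>degree p. scale (coeff p i) ((f ^^ i) v))"

lemma evalp_bound:
  assumes "degree p \<le> n"
  shows "evalp f p v = (\<Sum>i\<le>n. scale (coeff p i) ((f ^^ i) v))"
  unfolding evalp_def
  by (rule sum.mono_neutral_left) (use assms in \<open>auto simp: coeff_eq_0\<close>)

lemma evalp_linear_factor:
  assumes "Vector_Spaces.linear scale scale f"
  shows "evalp f ([:-a, 1:] * q) v = evalp f q (f v - scale a v)"
proof -
  note lin = linear_simps[OF linear_funpow[OF assms]]
  let ?n = "degree q"
  have "degree ([:-a, 1:] * q) \<le> Suc ?n"
    by (rule order.trans[OF degree_mult_le]) simp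
  hence "evalp f ([:-a, 1:] * q) v =
      (\<Sum>i\<le>Suc ?n. scale (coeff (pCons 0 q) i - a * coeff q i) ((f ^^ i) v))"
    by (simp add: evalp_bound algebra_simps del: sum.atMost_Suc)
  also have "\<dots> = (\<Sum>i\<le>Suc ?n. scale (coeff (pCons 0 q) i) ((f ^^ i) v)) -
      (\<Sum>i\<le>Suc ?n. scale (a * coeff q i) ((f ^^ i) v))"
    by (simp only: scale_left_diff_distrib sum_subtractf)
  also have "(\<Sum>i\<le>Suc ?n. scale (coeff (pCons 0 q) i) ((f ^^ i) v)) =
      (\<Sum>i\<le>?n. scale (coeff q i) ((f ^^ i) (f v)))"
    by (subst sum.atMost_Suc_shift) (simp add: funpow_swap1)
  also have "(\<Sum>i\<le>Suc ?n. scale (a * coeff q i) ((f ^^ i) v)) =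
      (\<Sum>i\<le>?n. scale (coeff q i) ((f ^^ i) (scale a v)))"
    by (simp add: coeff_eq_0 lin mult.commute)
  also have "(\<Sum>i\<le>?n. scale (coeff q i) ((f ^^ i) (f v))) - \<dots> = evalp f q (f v - scale a v)"
    by (simp add: evalp_def lin scale_right_diff_distrib sum_subtractf)
  finally show ?thesis .
qed

lemma annihilating_poly:
  assumes "finite A" "\<And>n. (f ^^ n) v \<in> span A"
  obtains p where "p \<noteq> 0" "evalp f p v = 0"
proof -
  obtain j where j: "(f ^^ j) v \<in> span ((\<lambda>i. (f ^^ i) v) ` {..<j})"
    using chain_in_span[of A "\<lambda>i. (f ^^ i) v"] assms by blast
  let ?E = "\<lambda>p. \<Sum>i\<le>j. scale (coeff p i) ((f ^^ i) v)"
  \<comment> \<open>Bounding the coefficients instead of the degree keeps the set closed under sums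
    and covers \<open>j = 0\<close>, where only the zero polynomial is left.\<close>
  let ?Q = "{?E p | p. \<forall>i\<ge>j. coeff p i = 0}"
  have "span ((\<lambda>i. (f ^^ i) v) ` {..<j}) \<subseteq> ?Q"
  proof (rule span_minimal)
    show "(\<lambda>i. (f ^^ i) v) ` {..<j} \<subseteq> ?Q"
    proof (rule image_subsetI, rule CollectI)
      fix i assume "i \<in> {..<j}"
      hence "(f ^^ i) v = ?E (monom 1 i) \<and> (\<forall>l\<ge>j. coeff (monom (1::'k) i) l = 0)"
        by (auto simp: coeff_monom if_distrib[of "\<lambda>c. scale c _"] cong: if_cong)
      thus "\<exists>p. (f ^^ i) v = ?E p \<and> (\<forall>l\<ge>j. coeff p l = 0)" by blast
    qed
    show "subspace ?Q"
    proof (rule subspaceI)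
      show "0 \<in> ?Q" by (intro CollectI exI[of _ 0]) simp
    next
      fix x y assume "x \<in> ?Q" "y \<in> ?Q"
      then obtain p q where "x = ?E p" "y = ?E q" "\<forall>i\<ge>j. coeff p i = 0" "\<forall>i\<ge>j. coeff q i = 0"
        by blast
      thus "x + y \<in> ?Q"
        by (intro CollectI exI[of _ "p + q"]) (simp add: scale_left_distrib sum.distrib)
    next
      fix c x assume "x \<in> ?Q"
      then obtain p where "x = ?E p" "\<forall>i\<ge>j. coeff p i = 0" by blast
      thus "scale c x \<in> ?Q"
        by (intro CollectI exI[of _ "smult c p"]) (simp add: scale_sum_right)
    qed
  qed
  then obtain q where q: "(f ^^ j) v = ?E q" "\<forall>i\<ge>j. coeff q i = 0" using j by blast
  let ?p = "monom 1 j - q"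
  have "coeff ?p j = 1" using q(2) by simp
  hence "?p \<noteq> 0" by auto
  moreover have "degree ?p \<le> j"
    using q(2) by (intro degree_diff_le degree_monom_le) (auto intro: degree_le)
  hence "evalp f ?p v = ?E (monom 1 j) - ?E q"
    by (simp add: evalp_bound scale_left_diff_distrib sum_subtractf)
  hence "evalp f ?p v = 0"
    by (simp add: q(1) coeff_monom if_distrib[of "\<lambda>c. scale c _"] cong: if_cong)
  ultimately show ?thesis using that by blast
qed

text \<open>
  Induction along the linear factors of a polynomial that annihilates \<open>v\<close>.
\<close>

lemma eigen_induct:
  assumes f: "Vector_Spaces.linear scale scale f" and W: "subspace W"
    and fW: "\<And>w. w \<in> W \<Longrightarrow> f w \<in> W" and A: "finite A" "W \<subseteq> span A" and v: "v \<in> W"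
    and zero: "P 0"
    and step: "\<And>a v. v \<in> W \<Longrightarrow> P (f v - scale a v) \<Longrightarrow> P v"
  shows "P v"
proof -
  have "(f ^^ n) v \<in> W" for n by (induction n) (auto simp: v fW)
  then obtain p where p: "p \<noteq> 0" "evalp f p v = 0"
    using annihilating_poly[of A f v] A by blast
  have "P v" if "degree p = n" "p \<noteq> 0" "evalp f p v = 0" "v \<in> W" for n p v
    using that
  proof (induction n arbitrary: p v)
    case 0
    then obtain c where "p = [:c:]" by (auto elim: degree_eq_zeroE)
    with 0 have "v = 0" by (simp add: evalp_def)
    thus ?case by (simp add: zero)
  next
    case (Suc n)
    have "\<exists>a. poly p a = 0"
      by (rule alg_closed_imp_poly_has_root) (use Suc.prems in simp)
    then obtain a q where q: "p = [:-a, 1:] * q" by (auto simp: poly_eq_0_iff_dvd)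
    hence "q \<noteq> 0" using Suc.prems by auto
    moreover from this have "degree q = n" using Suc.prems(1) unfolding q
      by (subst (asm) degree_mult_eq) auto
    ultimately have "P (f v - scale a v)"
      using Suc.prems by (intro Suc.IH[of q]) (auto simp: q evalp_linear_factor[OF f]
          intro!: subspace_diff[OF W] subspace_scale[OF W] fW simp del: mult_pCons_left)
    thus ?case using step Suc.prems by blast
  qed
  thus ?thesis using p v by blast
qed

lemma eigenvector_exists:
  assumes "Vector_Spaces.linear scale scale f" "subspace W"
    "\<And>w. w \<in> W \<Longrightarrow> f w \<in> W" "finite A" "W \<subseteq> span A" "v \<in> W" "v \<noteq> 0"
  obtains w c where "w \<in> W" "w \<noteq> 0" "f w = scale c w"
proof -
  have "v = 0 \<or> (\<exists>w\<in>W. w \<noteq> 0 \<and> (\<exists>c. f w = scale c w))"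
  proof (rule eigen_induct[OF assms(1-6)])
    fix a v assume "v \<in> W"
      "f v - scale a v = 0 \<or> (\<exists>w\<in>W. w \<noteq> 0 \<and> (\<exists>c. f w = scale c w))"
    thus "v = 0 \<or> (\<exists>w\<in>W. w \<noteq> 0 \<and> (\<exists>c. f w = scale c w))"
      by (cases "f v - scale a v = 0") auto
  qed auto
  thus ?thesis using assms(7) that by blast
qed

text \<open>\<open>ss\<close> says that \<open>f - a\<close> and its square have the same kernel on
  \<open>W\<close>, which excludes Jordan blocks of size two. In the induction
  \<open>f v - a v\<close> is a sum of eigenvectors; a preimage of it under \<open>f - a\<close>,
  exact up to the \<open>a\<close>-eigenspace, differs from \<open>v\<close> by an
  eigenvector.\<close>

lemma semisimple_span_eigenvectors:
  assumes f: "Vector_Spaces.linear scale scale f" and W: "subspace W"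
    and fW: "\<And>w. w \<in> W \<Longrightarrow> f w \<in> W" and A: "finite A" "W \<subseteq> span A"
    and ss: "\<And>w a. w \<in> W \<Longrightarrow> f (f w - scale a w) = scale a (f w - scale a w) \<Longrightarrow> f w = scale a w"
    and v: "v \<in> W"
  shows "v \<in> span {w \<in> W. \<exists>c. f w = scale c w}"
proof (rule eigen_induct[OF f W fW A v])
  note lin = linear_simps[OF f]
  let ?E = "{w \<in> W. \<exists>c. f w = scale c w}"
  fix a v assume vW: "v \<in> W" and IH: "f v - scale a v \<in> span ?E"
  have EW: "span ?E \<subseteq> W" by (rule span_minimal) (auto simp: W)
  \<comment> \<open>An eigenvector with eigenvalue \<open>b \<noteq> a\<close> is reached by
    dividing by \<open>b - a\<close>; one with \<open>b = a\<close> remains as an error in the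
    kernel of \<open>f - a\<close>.\<close>
  have "\<exists>z\<in>span ?E. f (f z - scale a z - y) = scale a (f z - scale a z - y)"
    if "y \<in> span ?E" for y
    using that
  proof (induction y rule: span_induct_alt)
    case base
    show ?case by (rule bexI[of _ 0]) (auto simp: lin span_zero)
  next
    case (step c w y)
    from step(2) obtain z where
      z: "z \<in> span ?E" "f (f z - scale a z - y) = scale a (f z - scale a z - y)" by blast
    from step(1) obtain b where b: "w \<in> W" "f w = scale b w" by blast
    show ?case
    proof (cases "b = a")
      case True
      show ?thesis
        by (rule bexI[of _ z]) (use z b True in \<open>auto simp: lin algebra_simps
            scale_right_distrib scale_right_diff_distrib\<close>)
    next
      case False
      let ?z = "z + scale (c / (b - a)) w"
      have "f ?z - scale a ?z - (scale c w + y) =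
          f z - scale a z - y + (scale ((c / (b - a)) * (b - a)) w - scale c w)"
        by (simp only: lin b right_diff_distrib scale_left_diff_distrib scale_right_distrib
            scale_scale mult.commute[of a]) simp
      also have "\<dots> = f z - scale a z - y" using False by simp
      finally have eq: "f ?z - scale a ?z - (scale c w + y) = f z - scale a z - y" .
      have "?z \<in> span ?E"
        using z(1) span_base[OF step(1)] by (intro span_add span_scale)
      thus ?thesis by (rule bexI[rotated]) (simp only: eq z(2))
    qed
  qed
  from this[OF IH] obtain z where z: "z \<in> span ?E"
    "f (f z - scale a z - (f v - scale a v)) = scale a (f z - scale a z - (f v - scale a v))"
    by blast
  have "f z - scale a z - (f v - scale a v) = f (z - v) - scale a (z - v)"
    by (simp add: lin scale_right_diff_distrib)
  moreover have "z - v \<in> W" using z(1) EW vW W by (auto intro: subspace_diff)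
  ultimately have "f (z - v) = scale a (z - v)" using z(2) ss[of "z - v" a] by simp
  hence "z - v \<in> span ?E" using \<open>z - v \<in> W\<close> by (intro span_base) blast
  hence "z - (z - v) \<in> span ?E" using z(1) by (rule span_diff[rotated])
  thus "v \<in> span ?E" by simp
qed (simp_all add: span_zero)

end

section \<open>Locally nilpotent and commuting operators\<close>

lemma (in vector_space) last_nonzero_power:
  assumes "(T ^^ k) v = 0" "v \<noteq> 0"
  obtains j where "(T ^^ j) v \<noteq> 0" "T ((T ^^ j) v) = 0"
proof -
  have "(T ^^ (LEAST k. (T ^^ k) v = 0)) v = 0" using assms(1) by (rule LeastI)
  moreover from this have "(LEAST k. (T ^^ k) v = 0) \<noteq> 0"
    using assms(2) by (metis funpow_0)
  then obtain j where j: "(LEAST k. (T ^^ k) v = 0) = Suc j" using not0_implies_Suc by blast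
  moreover have "(T ^^ j) v \<noteq> 0" using not_less_Least[of j "\<lambda>k. (T ^^ k) v = 0"] j by simp
  ultimately show ?thesis using that by simp
qed

text \<open>\<open>C\<close> is the commutator \<open>A T - T A\<close>. As it commutes with
  \<open>T\<close>, one has \<open>T^n A = A T^n - n C T^(n-1)\<close>, so one extra power of
  \<open>T\<close> is enough.\<close>

lemma funpow_kernel_stable:
  fixes A T C :: "'v::ab_group_add \<Rightarrow> 'v"
  assumes T0: "T 0 = 0" and C0: "C 0 = 0" and Td: "\<And>v w. T (v - w) = T v - T w"
    and TA: "\<And>v. T (A v) = A (T v) - C v" and TC: "\<And>v. T (C v) = C (T v)"
    and A0: "A 0 = 0" and k: "(T ^^ k) v = 0"
  shows "(T ^^ Suc k) (A v) = 0"
  using k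
proof (induction k arbitrary: v)
  case 0
  thus ?case by (simp add: A0 T0)
next
  case (Suc k)
  have d: "(T ^^ n) (x - y) = (T ^^ n) x - (T ^^ n) y" for n x y
    by (induction n) (simp_all add: Td)
  have c: "(T ^^ n) (C x) = C ((T ^^ n) x)" for n x
    by (induction n) (simp_all add: TC)
  have "(T ^^ Suc (Suc k)) (A v) = (T ^^ Suc k) (A (T v) - C v)"
    by (simp add: funpow_Suc_right TA del: funpow.simps)
  also have "\<dots> = (T ^^ Suc k) (A (T v)) - C ((T ^^ Suc k) v)" by (simp only: d c)
  also have "\<dots> = 0"
    using Suc.IH[of "T v"] Suc.prems by (simp add: C0 funpow_Suc_right del: funpow.simps)
  finally show ?case .
qed

context vector_space
begin

text \<open>The last nonzero power of a new \<open>T\<close> on a common null vector of the other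
  operators stays in their kernels by commutation. \<open>W\<close> is asked to be stable rather
  than a subspace because it will also be cut out of a union of weight spaces.\<close>

lemma common_kernel:
  assumes "finite F" and "\<And>T. T \<in> F \<Longrightarrow> T 0 = 0"
    and "\<And>T v. T \<in> F \<Longrightarrow> \<exists>k. (T ^^ k) v = 0"
    and "\<And>T T' v. T \<in> F \<Longrightarrow> T' \<in> F \<Longrightarrow> T (T' v) = T' (T v)"
    and "\<And>T w. T \<in> F \<Longrightarrow> w \<in> W \<Longrightarrow> T w \<in> W"
    and v: "v \<in> W" "v \<noteq> 0"
  obtains w where "w \<in> W" "w \<noteq> 0" "\<And>T. T \<in> F \<Longrightarrow> T w = 0"
proof -
  have "\<exists>w\<in>W. w \<noteq> 0 \<and> (\<forall>T\<in>F. T w = 0)"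
    using assms(1-5)
  proof (induction F rule: finite_induct)
    case empty
    thus ?case using v by auto
  next
    case (insert T F)
    have "\<exists>w\<in>W. w \<noteq> 0 \<and> (\<forall>T\<in>F. T w = 0)"
      using insert.prems by (intro insert.IH) simp_all
    then obtain w where w: "w \<in> W" "w \<noteq> 0" "\<And>T'. T' \<in> F \<Longrightarrow> T' w = 0" by blast
    obtain k where "(T ^^ k) w = 0" using insert.prems(2) by blast
    then obtain j where j: "(T ^^ j) w \<noteq> 0" "T ((T ^^ j) w) = 0"
      using last_nonzero_power[OF _ w(2)] by blast
    have TW: "T u \<in> W" if "u \<in> W" for u using insert.prems(4)[of T u] that by simp
    have T0: "T 0 = 0" using insert.prems(1)[of T] by simp
    have comm: "T' (T u) = T (T' u)" if "T' \<in> F" for T' u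
      using insert.prems(3)[of T' T u] that by simp
    have "(T ^^ j) w \<in> W" by (induction j) (simp_all add: w(1) TW)
    have swap: "T' ((T ^^ j) w) = (T ^^ j) (T' w)" if "T' \<in> F" for T'
      by (induction j) (simp_all add: comm[OF that])
    have pow0: "(T ^^ j) 0 = 0" by (induction j) (simp_all add: T0)
    have "\<forall>T'\<in>F. T' ((T ^^ j) w) = 0"
      using swap w(3) pow0 by metis
    with \<open>(T ^^ j) w \<in> W\<close> show ?case using j by (intro bexI[of _ "(T ^^ j) w"]) auto
  qed
  thus ?thesis using that by blast
qed

lemma fin_dim_basis:
  assumes "subspace W" "W \<subseteq> span A" "finite A"
  obtains B where "finite B" "independent B" "span B = W" "card B = dim W"
proof -
  obtain B where B: "B \<subseteq> W" "independent B" "W \<subseteq> span B" "card B = dim W"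
    using basis_exists .
  have "finite B" using independent_span_bound[OF assms(3) B(2)] B(1) assms(2) by blast
  moreover have "span B = W" using B(1,3) assms(1) by (simp add: span_subspace)
  ultimately show ?thesis using that B by blast
qed

lemma injective_image:
  assumes T: "Vector_Spaces.linear scale scale T" and inj: "inj T"
    and W: "subspace W" "W \<subseteq> span A" "finite A" and W': "subspace W'" "W' \<subseteq> span A'" "finite A'"
    and TW: "T ` W \<subseteq> W'"
  shows "dim W \<le> dim W'" and "dim W = dim W' \<Longrightarrow> T ` W = W'"
proof -
  interpret T: module_hom scale scale T using T by (simp add: linear_iff_module_hom)
  obtain B where B: "finite B" "independent B" "span B = W" "card B = dim W"
    using fin_dim_basis[OF W] .
  obtain B' where B': "finite B'" "independent B'" "span B' = W'" "card B' = dim W'"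
    using fin_dim_basis[OF W'] .
  have ind: "independent (T ` B)" using T.independent_inj_image[OF B(2) inj] .
  have card: "card (T ` B) = dim W" using inj B(4) by (simp add: card_image inj_on_subset)
  have sub: "T ` B \<subseteq> span B'" using TW B(3) B'(3) span_base by blast
  show "dim W \<le> dim W'"
    using independent_span_bound[OF B'(1) ind sub] card B'(4) by simp
  show "T ` W = W'" if eq: "dim W = dim W'"
  proof (rule ccontr)
    assume "T ` W \<noteq> W'"
    then obtain w where w: "w \<in> W'" "w \<notin> T ` W" using TW by blast
    hence nw: "w \<notin> span (T ` B)" by (simp add: T.span_image B(3))
    hence "independent (insert w (T ` B))" using ind by (rule independent_insertI)
    from independent_span_bound[OF B'(1) this] sub w(1) B'(3)
    have "card (insert w (T ` B)) \<le> card B'" by blast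
    moreover have "w \<notin> T ` B" using nw span_base by metis
    ultimately show False using B(1) card eq B'(4) by simp
  qed
qed

end

section \<open>Representations of \<open>\<gg> \<otimes> S\<close> as bilinear actions\<close>

context lie_algebra
begin

lemma br_linear:
  "Vector_Spaces.linear scale scale (br x)" "Vector_Spaces.linear scale scale (\<lambda>x. br x y)"
  by (rule linearI; simp add: br_add_left br_add_right br_scale_left br_scale_right)+

lemmas br_simps = linear_simps[OF br_linear(1)] linear_simps[OF br_linear(2)]

lemma br_antisym: "br x y = - br y x"
proof -
  have "br x y + br y x = br (x + y) (x + y)" by (simp only: br_add_left br_add_right) (simp add: br_self)
  thus ?thesis by (simp add: br_self eq_neg_iff_add_eq_0)
qed

lemma br_br: "br x (br y z) = br (br x y) z + br y (br x z)"
proof -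
  have "br x (br y z) = - br z (br x y) - br y (br z x)"
    using jacobi[of x y z] by (simp add: algebra_simps eq_neg_iff_add_eq_0)
  moreover have "- br z (br x y) = br (br x y) z" using br_antisym[of z "br x y"] by simp
  moreover have "- br y (br z x) = br y (br x z)" using br_antisym[of z x] by (simp add: br_simps)
  ultimately show ?thesis by simp
qed

lemma simple_span_brackets:
  assumes "simple"
  shows "span {br x y | x y. True} = UNIV"
proof -
  let ?D = "span {br x y | x y. True}"
  have "lie_ideal ?D"
    unfolding lie_ideal_def by (auto intro!: span_base)
  moreover obtain x y where "br x y \<noteq> 0" using assms by (auto simp: simple_def)
  hence "?D \<noteq> {0}" using span_base[of "br x y" "{br x y | x y. True}"] by blast
  ultimately show ?thesis using assms by (auto simp: simple_def)
qed

end

text \<open>This is the action of pure tensors alone. It keeps the cosets of the tensor product out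
  of the weight arguments; they return when the kernel is computed.\<close>

locale current_rep =
  G: lie_algebra scaleG br + S: unital_comm_algebra scaleS e + V: alg_closed_vector_space scaleV
  for scaleG :: "'k::{alg_closed_field, field_char_0} \<Rightarrow> 'g::ab_group_add \<Rightarrow> 'g"
    and br :: "'g \<Rightarrow> 'g \<Rightarrow> 'g"
    and scaleS :: "'k \<Rightarrow> 's::comm_ring \<Rightarrow> 's"
    and e :: 's
    and scaleV :: "'k \<Rightarrow> 'v::ab_group_add \<Rightarrow> 'v" +
  fixes act :: "'g \<Rightarrow> 's \<Rightarrow> 'v \<Rightarrow> 'v"
  assumes act_linear: "Vector_Spaces.linear scaleV scaleV (act x s)"
    and act_linear_g: "Vector_Spaces.linear scaleG scaleV (\<lambda>x. act x s v)"
    and act_linear_s: "Vector_Spaces.linear scaleS scaleV (\<lambda>s. act x s v)"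
    and act_br: "act (br x y) (r * s) v = act x r (act y s v) - act y s (act x r v)"
begin

lemmas act_simps = linear_simps[OF act_linear]
lemmas act_g_simps = linear_simps[OF act_linear_g]
lemmas act_s_simps = linear_simps[OF act_linear_s]

text \<open>This set turns out to be I(V), see \<open>ideal_of_module_eq\<close>.\<close>

definition ann :: "'s set" where
  "ann = {s. \<forall>x v. act x s v = 0}"

definition invariant :: "'v set \<Rightarrow> bool" where
  "invariant W \<longleftrightarrow> V.subspace W \<and> (\<forall>x s. \<forall>w\<in>W. act x s w \<in> W)"

definition nil :: "'g \<Rightarrow> 's \<Rightarrow> bool" where
  "nil x s \<longleftrightarrow> (\<forall>v. \<exists>k. (act x s ^^ k) v = 0)"

definition wt_space :: "'g set \<Rightarrow> ('g \<Rightarrow> 'k) \<Rightarrow> 'v set" where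
  "wt_space H l = {v. \<forall>h\<in>H. act h e v = scaleV (l h) v}"

lemma act_br_e: "act (br x y) s v = act x e (act y s v) - act y s (act x e v)"
  using act_br[of x y e s v] by (simp add: S.unit_mult)

lemma subspace_wt_space: "V.subspace (wt_space H l)"
  by (rule V.subspaceI)
    (auto simp: wt_space_def act_simps V.scale_right_distrib mult.commute)

end

locale simple_current_rep = current_rep +
  assumes fin_g: "fin_dim scaleG (UNIV :: 'b set)" and simple: "G.simple"
begin

lemma span_brackets: "G.span {br x y | x y. True} = UNIV"
  using G.simple_span_brackets simple .

text \<open>\<open>[x, y] \<otimes> a b\<close> is the commutator of \<open>x \<otimes> a\<close>
  and \<open>y \<otimes> b\<close>, and brackets span the Lie algebra.\<close>

lemma ann_mult:
  assumes "a \<in> ann" shows "a * b \<in> ann"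
proof -
  have "act z (a * b) v = 0" for z v
  proof -
    have "z \<in> G.span {br x y | x y. True}" unfolding span_brackets by simp
    thus ?thesis
    proof (induction z rule: G.span_induct_alt)
      case (step c x y)
      thus ?case using assms by (auto simp: act_g_simps act_br ann_def act_simps)
    qed (simp add: act_g_simps)
  qed
  thus ?thesis by (simp add: ann_def)
qed

lemma ann_ideal: "S.ring_ideal ann"
proof -
  have "r * p \<in> ann" if "p \<in> ann" for p r
    using ann_mult[OF that, of r] by (simp add: mult.commute)
  thus ?thesis unfolding S.ring_ideal_def by (simp add: ann_def act_s_simps)
qed

lemma act_commute:
  assumes "a * b \<in> ann"
  shows "act x a (act y b v) = act y b (act x a v)"
  using act_br[of x y a b v] assms by (simp add: ann_def)

lemma g_fin: obtains A where "finite A" "G.span A = UNIV"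
  using fin_g by (auto simp: fin_dim_def)

end

text \<open>\<open>e_notin_ann\<close> excludes the zero action, which is simple in dimension one;
  there \<open>ann\<close> is all of S.\<close>

locale irreducible_current_rep = simple_current_rep +
  assumes irr: "invariant W \<Longrightarrow> W = {0} \<or> W = UNIV"
    and e_notin_ann: "e \<notin> ann"
begin

lemma nonzero: "\<exists>v::'d. v \<noteq> 0"
  using e_notin_ann by (auto simp: ann_def)

lemma generalised_eigenspace:
  assumes t: "t * t \<in> ann" and v: "act x t v = scaleV c v" "v \<noteq> 0"
  shows "\<exists>k. ((\<lambda>w. act x t w - scaleV c w) ^^ k) w = 0"
proof -
  let ?T = "\<lambda>w. act x t w - scaleV c w"
  let ?W = "{w. \<exists>k. (?T ^^ k) w = 0}"
  have T: "Vector_Spaces.linear scaleV scaleV ?T" by (rule V.linear_shift[OF act_linear])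
  note lin = linear_simps[OF V.linear_funpow[OF T]]
  have mono: "(?T ^^ (i + k)) w = 0" if "(?T ^^ k) w = 0" for i k w
    by (induction i) (use that in \<open>simp_all add: act_simps\<close>)
  have "invariant ?W"
    unfolding invariant_def
  proof (intro conjI allI ballI)
    show "V.subspace ?W"
    proof (rule V.subspaceI)
      show "0 \<in> ?W" by (auto simp: lin)
      fix u w a assume "u \<in> ?W"
      then obtain k where k: "(?T ^^ k) u = 0" by blast
      thus "scaleV a u \<in> ?W" by (intro CollectI exI[of _ k]) (simp add: lin)
      assume "w \<in> ?W"
      then obtain l where "(?T ^^ l) w = 0" by blast
      hence "(?T ^^ (k + l)) (u + w) = 0"
        using mono[OF k, of l] mono[of l w k] by (simp add: lin add.commute)
      thus "u + w \<in> ?W" by blast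
    qed
    fix y r w assume "w \<in> ?W"
    then obtain k where k: "(?T ^^ k) w = 0" by blast
    \<comment> \<open>The commutator of \<open>y \<otimes> r\<close> and
      \<open>x \<otimes> t\<close> is \<open>[y, x] \<otimes> r t\<close>. It commutes with
      \<open>x \<otimes> t\<close> by this membership, as \<open>funpow_kernel_stable\<close>
      requires.\<close>
    have "t * (r * t) \<in> ann" using ann_mult[OF t, of r] by (simp add: ac_simps)
    note comm = act_commute[OF this]
    have "(?T ^^ Suc k) (act y r w) = 0"
    proof (rule funpow_kernel_stable[where T = ?T and A = "act y r" and C = "act (br y x) (r * t)"])
      show "act x t (act y r v) - scaleV c (act y r v) =
          act y r (act x t v - scaleV c v) - act (br y x) (r * t) v" for v
        by (simp add: act_simps act_br)
    qed (simp_all add: act_simps comm k V.scale_right_diff_distrib)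
    thus "act y r w \<in> ?W" by blast
  qed
  moreover have "(?T ^^ 1) v = 0" using v by simp
  hence "v \<in> ?W" by blast
  ultimately have "?W = UNIV" using irr v(2) by blast
  thus ?thesis by blast
qed

text \<open>V is a single generalised eigenspace, so one null vector decides about all of V.\<close>

lemma nil_if_kernel:
  assumes "t * t \<in> ann" "act x t v = 0" "v \<noteq> 0"
  shows "nil x t"
  using generalised_eigenspace[of t x v 0] assms by (simp add: nil_def)

text \<open>Sums are the point: \<open>x \<otimes> t\<close> and \<open>y \<otimes> t\<close>
  commute, so they share a null vector, which \<open>(x + y) \<otimes> t\<close> kills too.\<close>

lemma subspace_nil:
  assumes t: "t * t \<in> ann"
  shows "G.subspace {x. nil x t}"
proof (rule G.subspaceI)
  obtain v :: 'd where v: "v \<noteq> 0" using nonzero by blast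
  show "0 \<in> {x. nil x t}" using nil_if_kernel[OF t _ v] by (simp add: act_g_simps)
  fix x y c assume x: "x \<in> {x. nil x t}"
  show "scaleG c x \<in> {x. nil x t}"
  proof -
    obtain w where "w \<noteq> 0" "act x t w = 0"
      using V.common_kernel[of "{act x t}" UNIV v] x v by (auto simp: nil_def act_simps)
    thus ?thesis using nil_if_kernel[OF t, of _ w] by (simp add: act_g_simps)
  qed
  assume y: "y \<in> {x. nil x t}"
  obtain w where w: "w \<noteq> 0" "\<And>T. T \<in> {act x t, act y t} \<Longrightarrow> T w = 0"
  proof (rule V.common_kernel[of "{act x t, act y t}" UNIV v])
    show "\<exists>k. (T ^^ k) u = 0" if "T \<in> {act x t, act y t}" for T u
      using that x y by (auto simp: nil_def)
    show "T (T' u) = T' (T u)" if "T \<in> {act x t, act y t}" "T' \<in> {act x t, act y t}" for T T' u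
      using that act_commute[OF t] by auto
  qed (use v in \<open>auto simp: act_simps\<close>)
  have "act x t w = 0" "act y t w = 0" by (rule w(2); simp)+
  hence "act (x + y) t w = 0" by (simp add: act_g_simps)
  thus "x + y \<in> {x. nil x t}" using nil_if_kernel[OF t _ w(1)] by simp
qed

end

section \<open>Bounded weight representations\<close>

locale weight_rep = irreducible_current_rep scaleG br scaleS e scaleV act
  for scaleG :: "'k::{alg_closed_field, field_char_0} \<Rightarrow> 'g::ab_group_add \<Rightarrow> 'g"
    and br :: "'g \<Rightarrow> 'g \<Rightarrow> 'g"
    and scaleS :: "'k \<Rightarrow> 's::comm_ring \<Rightarrow> 's"
    and e :: 's
    and scaleV :: "'k \<Rightarrow> 'v::ab_group_add \<Rightarrow> 'v"
    and act :: "'g \<Rightarrow> 's \<Rightarrow> 'v \<Rightarrow> 'v" +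
  fixes H :: "'g set" and B :: nat
  assumes cartan: "G.cartan_subalgebra H"
    and decomp: "direct_sum_decomp (dual_of scaleG H) (wt_space H)"
    and fin_wt: "l \<in> dual_of scaleG H \<Longrightarrow> fin_dim scaleV (wt_space H l)"
    and bounded: "l \<in> dual_of scaleG H \<Longrightarrow> V.dim (wt_space H l) \<le> B"
begin

section \<open>Weight vectors in V and root vectors in the Lie algebra\<close>

abbreviation "dual \<equiv> dual_of scaleG H"
abbreviation "wt \<equiv> wt_space H"

lemma subspace_H: "G.subspace H"
  using cartan by (simp add: G.cartan_subalgebra_def G.lie_subalgebra_def)

lemma wt_fin_span:
  assumes "l \<in> dual"
  obtains A where "finite A" "wt l \<subseteq> V.span A"
  using fin_wt[OF assms] by (auto simp: fin_dim_def)

lemma weight_decomposition: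
  obtains f where "\<And>l. l \<in> dual \<Longrightarrow> f l \<in> wt l" "\<And>l. l \<notin> dual \<Longrightarrow> f l = 0"
    "finite {l. f l \<noteq> 0}" "v = (\<Sum>l | f l \<noteq> 0. f l)"
  using decomp unfolding direct_sum_decomp_def by metis

lemma weight_induct:
  assumes "P 0" "\<And>v w. P v \<Longrightarrow> P w \<Longrightarrow> P (v + w)" "\<And>l v. l \<in> dual \<Longrightarrow> v \<in> wt l \<Longrightarrow> P v"
  shows "P v"
proof -
  obtain f where f: "\<And>l. l \<in> dual \<Longrightarrow> f l \<in> wt l" "\<And>l. l \<notin> dual \<Longrightarrow> f l = 0"
    "finite {l. f l \<noteq> 0}" "v = (\<Sum>l | f l \<noteq> 0. f l)"
    using weight_decomposition[where v = v] by blast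
  have Pf: "P (f l)" for l using f(1,2) assms(1,3) by (cases "l \<in> dual") auto
  have "P (sum f F)" if "finite F" for F
    using that by (induction F rule: finite_induct) (auto intro: assms(1,2) Pf)
  thus ?thesis using f(3,4) by simp
qed

lemma nonzero_weight_vector: obtains l v where "l \<in> dual" "v \<in> wt l" "v \<noteq> 0"
proof -
  have "\<exists>l\<in>dual. \<exists>v\<in>wt l. v \<noteq> 0"
  proof (rule ccontr)
    assume *: "\<not> ?thesis"
    have "v = 0" for v :: 'v by (induction v rule: weight_induct) (use * in auto)
    thus False using nonzero by blast
  qed
  thus ?thesis using that by blast
qed

text \<open>\<open>(h - b)^2\<close> multiplies the component of weight \<open>l\<close> by
  \<open>(l h - b)^2\<close>. Uniqueness of the decomposition of 0 makes all these components
  vanish, and then those of \<open>(h - b) u\<close> vanish as well.\<close>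

lemma act_H_semisimple:
  assumes h: "h \<in> H"
    and u: "act h e (act h e u - scaleV b u) = scaleV b (act h e u - scaleV b u)"
  shows "act h e u = scaleV b u"
proof -
  obtain f where f: "\<And>l. l \<in> dual \<Longrightarrow> f l \<in> wt l" "\<And>l. l \<notin> dual \<Longrightarrow> f l = 0"
    "finite {l. f l \<noteq> 0}" "u = (\<Sum>l | f l \<noteq> 0. f l)"
    using weight_decomposition[where v = u] by blast
  define g where "g l = scaleV ((l h - b) * (l h - b)) (f l)" for l
  have D: "act h e (f l) = scaleV (l h) (f l)" for l
    using f(1,2)[of l] h by (cases "l \<in> dual") (auto simp: wt_space_def act_simps)
  have sum_D: "act h e (\<Sum>l | f l \<noteq> 0. scaleV (c l) (f l)) -
      scaleV b (\<Sum>l | f l \<noteq> 0. scaleV (c l) (f l)) =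
      (\<Sum>l | f l \<noteq> 0. scaleV ((l h - b) * c l) (f l))" for c
    by (simp add: act_simps D V.scale_sum_right V.scale_left_diff_distrib algebra_simps
        flip: sum_subtractf)
  have Du: "act h e u - scaleV b u = (\<Sum>l | f l \<noteq> 0. scaleV (l h - b) (f l))"
    using sum_D[of "\<lambda>_. 1"] f(4) by simp
  have "(\<Sum>l | f l \<noteq> 0. g l) = 0"
    unfolding g_def sum_D[symmetric] using u by (simp add: Du)
  moreover have "(\<Sum>l | f l \<noteq> 0. g l) = (\<Sum>l | g l \<noteq> 0. g l)"
    by (rule sum.mono_neutral_right) (auto simp: g_def f(3))
  ultimately have sum_g: "0 = (\<Sum>l | g l \<noteq> 0. g l)" by simp
  \<comment> \<open>\<open>Q\<close> is the condition in \<open>decomp\<close> for the vector 0;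
    both \<open>g\<close> and the zero family satisfy it.\<close>
  define Q where "Q p \<longleftrightarrow> (\<forall>l\<in>dual. p l \<in> wt l) \<and> (\<forall>l. l \<notin> dual \<longrightarrow> p l = 0) \<and>
      finite {l. p l \<noteq> 0} \<and> (0::'v) = (\<Sum>l | p l \<noteq> 0. p l)" for p
  have "\<exists>!p. Q p"
    using decomp unfolding direct_sum_decomp_def Q_def by (rule spec)
  moreover have "finite {l. g l \<noteq> 0}" by (rule finite_subset[OF _ f(3)]) (auto simp: g_def)
  hence "Q g"
    using f(1,2) sum_g
    by (auto simp: Q_def g_def intro: V.subspace_scale[OF subspace_wt_space])
  moreover have "Q (\<lambda>_. 0)"
    using V.subspace_0[OF subspace_wt_space] by (simp add: Q_def)
  ultimately have "g = (\<lambda>_. 0)" by blast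
  hence "scaleV (l h - b) (f l) = 0" for l
    by (auto simp: g_def dest: fun_cong[of _ _ l])
  hence "act h e u - scaleV b u = 0" unfolding Du by (intro sum.neutral ballI)
  thus ?thesis by simp
qed

text \<open>The kernel is a proper ideal of a simple Lie algebra. This carries identities from V,
  where \<open>H\<close> acts diagonally, back to the Lie algebra.\<close>

lemma act_e_faithful:
  assumes "\<And>v. act z e v = 0"
  shows "z = 0"
proof -
  let ?K = "{z. \<forall>v. act z e v = 0}"
  have "G.lie_ideal ?K"
    unfolding G.lie_ideal_def
    by (auto intro!: G.subspaceI simp: act_g_simps act_br_e act_simps)
  hence "?K = {0} \<or> ?K = UNIV" using simple unfolding G.simple_def by blast
  moreover have "?K \<noteq> UNIV"
    using e_notin_ann by (auto simp: ann_def)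
  ultimately show ?thesis using assms by blast
qed

text \<open>By definition \<open>H\<close> is only nilpotent and self-normalising; it is commutative
  because its elements act as scalars on each weight space.\<close>

lemma H_abelian:
  assumes "h \<in> H" "h' \<in> H" shows "br h h' = 0"
proof (rule act_e_faithful)
  fix v show "act (br h h') e v = 0"
    by (induction v rule: weight_induct)
      (use assms in \<open>auto simp: act_simps act_br_e wt_space_def V.scale_left_commute\<close>)
qed

lemma centralizer_H:
  assumes "\<And>h. h \<in> H \<Longrightarrow> br h x = 0" shows "x \<in> H"
proof -
  have "br x y \<in> H" if "y \<in> H" for y
    using G.br_antisym[of x y] assms[OF that] G.subspace_0[OF subspace_H] by simp
  hence "x \<in> G.normalizer H" by (simp add: G.normalizer_def)
  thus ?thesis using cartan by (simp add: G.cartan_subalgebra_def)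
qed

text \<open>Put \<open>y = (ad h - a) w\<close>, so that \<open>(ad h - a) y = 0\<close>. On
  \<open>v\<close> of weight \<open>l\<close> this becomes \<open>(h - b) w v = y v\<close> and
  \<open>(h - b) y v = 0\<close> with \<open>b = l h + a\<close>. Semisimplicity of \<open>h\<close>
  on V gives \<open>y v = 0\<close>, and faithfulness \<open>y = 0\<close>.\<close>

lemma ad_H_semisimple:
  assumes h: "h \<in> H" and w: "br h (br h w - scaleG a w) = scaleG a (br h w - scaleG a w)"
  shows "br h w = scaleG a w"
proof -
  define y where "y = br h w - scaleG a w"
  have y: "br h y = scaleG a y" and hw: "br h w = y + scaleG a w"
    using w by (simp_all add: y_def)
  have "act y e v = 0" for v
  proof (induction v rule: weight_induct)
    case (3 l v)
    let ?b = "l h + a"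
    have hv: "act h e v = scaleV (l h) v" using 3 h by (simp add: wt_space_def)
    have 1: "act h e (act w e v) - scaleV ?b (act w e v) = act y e v"
      using act_br_e[of h w e v]
      by (simp add: hw hv act_simps act_g_simps V.scale_left_distrib algebra_simps)
    have 2: "act h e (act y e v) = scaleV ?b (act y e v)"
      using act_br_e[of h y e v]
      by (simp add: y hv act_simps act_g_simps V.scale_left_distrib algebra_simps)
    have "act h e (act w e v) = scaleV ?b (act w e v)"
      by (rule act_H_semisimple[OF h]) (simp only: 1 2)
    thus ?case using 1 by simp
  qed (simp_all add: act_simps)
  hence "y = 0" by (rule act_e_faithful)
  thus ?thesis by (simp add: hw)
qed

text \<open>The cases \<open>\<alpha> = 0\<close> and \<open>x = 0\<close> are allowed, so that
  elements of \<open>H\<close> are covered.\<close>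

definition root :: "('g \<Rightarrow> 'k) \<Rightarrow> 'g \<Rightarrow> bool" where
  "root \<alpha> x \<longleftrightarrow> \<alpha> \<in> dual \<and> (\<forall>h\<in>H. br h x = scaleG (\<alpha> h) x)"

text \<open>A joint eigenspace for \<open>C\<close> is stable under \<open>h0\<close> because
  \<open>H\<close> is abelian, and \<open>ad_H_semisimple\<close> splits it further.\<close>

lemma joint_eigenvectors_span:
  assumes "finite C" "C \<subseteq> H"
  shows "G.span {y. \<forall>h\<in>C. \<exists>c. br h y = scaleG c y} = UNIV"
  using assms
proof (induction C rule: finite_induct)
  case (insert h0 C)
  let ?E = "\<lambda>C. {y. \<forall>h\<in>C. \<exists>c. br h y = scaleG c y}"
  have "?E C \<subseteq> G.span (?E (insert h0 C))"
  proof
    fix y assume "y \<in> ?E C"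
    then obtain c where c: "\<And>h. h \<in> C \<Longrightarrow> br h y = scaleG (c h) y"
      by (simp add: Ball_def) metis
    let ?W = "{z. \<forall>h\<in>C. br h z = scaleG (c h) z}"
    obtain A where A: "finite A" "G.span A = UNIV" using g_fin .
    have GA: "alg_closed_vector_space scaleG"
      using G.vector_space_axioms by (simp add: alg_closed_vector_space_def)
    have "y \<in> G.span {w \<in> ?W. \<exists>c. br h0 w = scaleG c w}"
    proof (rule alg_closed_vector_space.semisimple_span_eigenvectors[OF GA G.br_linear(1)])
      show "G.subspace ?W"
        by (rule G.subspaceI)
          (simp_all add: G.br_simps G.scale_right_distrib G.scale_left_commute)
      show "br h0 w \<in> ?W" if "w \<in> ?W" for w
        using that insert.prems H_abelian
        by (auto simp: G.br_br[of _ h0] G.br_simps)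
      show "finite A" "?W \<subseteq> G.span A" using A by auto
      show "y \<in> ?W" using c by simp
      show "br h0 w = scaleG a w"
        if "br h0 (br h0 w - scaleG a w) = scaleG a (br h0 w - scaleG a w)" for w a
        using ad_H_semisimple[OF _ that] insert.prems by simp
    qed
    moreover have "{w \<in> ?W. \<exists>c. br h0 w = scaleG c w} \<subseteq> ?E (insert h0 C)" by auto
    ultimately show "y \<in> G.span (?E (insert h0 C))" using G.span_mono by blast
  qed
  hence "G.span (?E C) \<subseteq> G.span (?E (insert h0 C))" by (rule G.span_minimal) simp
  thus ?case using insert by auto
qed simp

lemma zero_dual: "(\<lambda>h\<in>H. 0) \<in> dual"
  using G.subspace_add[OF subspace_H] G.subspace_scale[OF subspace_H]
  by (auto simp: dual_of_def)

lemma add_dual: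
  assumes "l \<in> dual" "m \<in> dual" shows "(\<lambda>h\<in>H. l h + m h) \<in> dual"
  using assms G.subspace_add[OF subspace_H] G.subspace_scale[OF subspace_H]
  by (auto simp: dual_of_def algebra_simps)

lemma rootI:
  assumes "\<And>h. h \<in> H \<Longrightarrow> \<exists>c. br h x = scaleG c x"
  shows "\<exists>\<alpha>. root \<alpha> x"
proof (cases "x = 0")
  case True
  thus ?thesis using zero_dual by (auto simp: root_def G.br_simps)
next
  case False
  obtain c where c: "\<And>h. h \<in> H \<Longrightarrow> br h x = scaleG (c h) x" using assms by metis
  have "c (h + k) = c h + c k" if "h \<in> H" "k \<in> H" for h k
    using c[of "h + k"] c[OF that(1)] c[OF that(2)] G.subspace_add[OF subspace_H that] False
    by (simp add: G.br_simps flip: G.scale_left_distrib)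
  moreover have "c (scaleG a h) = a * c h" if "h \<in> H" for a h
    using c[of "scaleG a h"] c[OF that] G.subspace_scale[OF subspace_H that] False
    by (simp add: G.br_simps)
  ultimately have "restrict c H \<in> dual"
    using G.subspace_add[OF subspace_H] G.subspace_scale[OF subspace_H]
    by (auto simp: dual_of_def)
  thus ?thesis using c by (auto simp: root_def)
qed

lemma roots_span: "G.span {x. \<exists>\<alpha>. root \<alpha> x} = UNIV"
proof -
  obtain A where A: "finite A" "G.span A = UNIV" using g_fin .
  obtain C where C: "C \<subseteq> H" "finite C" "H \<subseteq> G.span C"
    using G.fin_dim_basis[OF subspace_H, of A] A G.span_superset by (metis subset_UNIV order_refl)
  have "{y. \<forall>h\<in>C. \<exists>c. br h y = scaleG c y} \<subseteq> {x. \<exists>\<alpha>. root \<alpha> x}"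
  proof (rule subsetI, rule CollectI, rule rootI)
    fix y h assume y: "y \<in> {y. \<forall>h\<in>C. \<exists>c. br h y = scaleG c y}" and "h \<in> H"
    hence "h \<in> G.span C" using C(3) by blast
    thus "\<exists>c. br h y = scaleG c y"
    proof (induction h rule: G.span_induct_alt)
      case base
      show ?case by (rule exI[of _ 0]) (simp add: G.br_simps)
    next
      case (step a h k)
      then obtain c d where "br h y = scaleG c y" "br k y = scaleG d y" using y by blast
      thus ?case by (intro exI[of _ "a * c + d"]) (simp add: G.br_simps G.scale_left_distrib)
    qed
  qed
  from G.span_mono[OF this] show ?thesis using joint_eigenvectors_span[OF C(2,1)] by auto
qed

lemma act_root_shift:
  assumes "root \<alpha> x" "h \<in> H" "act h e v = scaleV m v"
  shows "act h e (act x s v) = scaleV (m + \<alpha> h) (act x s v)"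
  using act_br_e[of h x s v] assms
  by (simp add: root_def act_simps act_g_simps V.scale_left_distrib algebra_simps)

lemma act_root_wt:
  assumes "root \<alpha> x" "v \<in> wt l"
  shows "act x s v \<in> wt (\<lambda>h\<in>H. l h + \<alpha> h)"
  using act_root_shift[OF assms(1)] assms(2) by (simp add: wt_space_def)

lemma root_H: "h \<in> H \<Longrightarrow> root (\<lambda>h\<in>H. 0) h"
  using zero_dual by (simp add: root_def H_abelian)

lemma act_H_wt:
  assumes "h \<in> H" "v \<in> wt l" shows "act h s v \<in> wt l"
  using act_root_shift[OF root_H[OF assms(1)]] assms(2) by (simp add: wt_space_def)

end

context weight_rep
begin

section \<open>Nilpotency of the square-zero part\<close>

text \<open>
  If \<open>x \<otimes> t\<close> were injective, it would eventually identify the weight spaces along the string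
  of the root, by boundedness. There the quotient of \<open>x \<otimes> e\<close> by \<open>x \<otimes> t\<close> has a nonzero scalar as
  commutator with \<open>h0 \<otimes> t\<close>, which is impossible in finite dimension.
\<close>

lemma nil_root:
  assumes t: "t * t \<in> ann" and x: "root \<alpha> x" and h0: "h0 \<in> H" "\<alpha> h0 \<noteq> 0"
  shows "nil x t"
proof (rule ccontr)
  assume not_nil: "\<not> nil x t"
  have inj: "v = 0" if "act x t v = 0" for v
    using nil_if_kernel[OF t that] not_nil by blast
  have injT: "inj (act x t)"
  proof (rule injI)
    fix u w assume "act x t u = act x t w"
    thus "u = w" using inj[of "u - w"] by (simp add: act_simps)
  qed
  have \<alpha>: "\<alpha> \<in> dual" using x by (simp add: root_def)
  obtain l0 v0 where l0: "l0 \<in> dual" and v0: "v0 \<in> wt l0" "v0 \<noteq> 0"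
    using nonzero_weight_vector .
  define L where "L k = ((\<lambda>l. \<lambda>h\<in>H. l h + \<alpha> h) ^^ k) l0" for k
  have L_0: "L 0 = l0" by (simp add: L_def)
  have L_Suc: "L (Suc k) = (\<lambda>h\<in>H. L k h + \<alpha> h)" for k
    by (simp only: L_def funpow.simps o_apply)
  have L_dual: "L k \<in> dual" for k
    by (induction k) (simp_all only: L_0 L_Suc l0 add_dual[OF _ \<alpha>])
  have L_shift: "act x s v \<in> wt (L (Suc k))" if "v \<in> wt (L k)" for s v k
    unfolding L_Suc using act_root_wt[OF x that] .
  have L_nonzero: "\<exists>v\<in>wt (L k). v \<noteq> 0" for k
  proof (induction k)
    case 0
    show ?case using v0 unfolding L_0 by blast
  next
    case (Suc k)
    then obtain v where "v \<in> wt (L k)" "v \<noteq> 0" by blast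
    thus ?case using L_shift[of v k t] inj[of v] by blast
  qed
  \<comment> \<open>The dimensions along the string are at most \<open>B\<close>, hence attain a
    maximum; there the injection into the next weight space must be onto.\<close>
  have "\<exists>k. \<forall>j. V.dim (wt (L j)) \<le> V.dim (wt (L k))"
    using ex_has_greatest_nat[of "\<lambda>_. True" 0 "\<lambda>k. V.dim (wt (L k))" "Suc B"] bounded[OF L_dual]
    by (auto simp: less_Suc_eq_le)
  then obtain k where k: "\<And>j. V.dim (wt (L j)) \<le> V.dim (wt (L k))" by blast
  obtain A where A: "finite A" "wt (L k) \<subseteq> V.span A" using wt_fin_span[OF L_dual] .
  obtain A' where A': "finite A'" "wt (L (Suc k)) \<subseteq> V.span A'" using wt_fin_span[OF L_dual] .
  note image = V.injective_image[OF act_linear[of x t] injT subspace_wt_space A(2,1)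
      subspace_wt_space A'(2,1)]
  have sub: "act x t ` wt (L k) \<subseteq> wt (L (Suc k))" using L_shift by blast
  have onto: "act x t ` wt (L k) = wt (L (Suc k))"
    using image(1)[OF sub] k[of "Suc k"] by (intro image(2)[OF sub]) simp
  obtain v where v: "v \<in> wt (L k)" "v \<noteq> 0" using L_nonzero by blast
  obtain w b where w: "w \<in> wt (L k)" "w \<noteq> 0" "act h0 t w = scaleV b w"
    by (rule V.eigenvector_exists[OF act_linear[of h0 t] subspace_wt_space act_H_wt[OF h0(1)] A v])
  define D where "D u = act h0 t u - scaleV b u" for u
  have D: "Vector_Spaces.linear scaleV scaleV D"
    unfolding D_def by (rule V.linear_shift[OF act_linear])
  \<comment> \<open>\<open>R\<close> will be the quotient of \<open>x \<otimes> e\<close> by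
    \<open>x \<otimes> t\<close>, and \<open>u j = R^j w\<close> the ladder. \<open>D\<close> was
    shifted by the eigenvalue \<open>b\<close> to make \<open>u 0\<close> a null vector.\<close>
  have "\<exists>z\<in>wt (L k). act x t z = act x e y" if "y \<in> wt (L k)" for y
    using L_shift[OF that, of e] onto by (metis imageE)
  then obtain R where R: "\<And>y. y \<in> wt (L k) \<Longrightarrow> R y \<in> wt (L k)"
    "\<And>y. y \<in> wt (L k) \<Longrightarrow> act x t (R y) = act x e y" by metis
  define u where "u j = (R ^^ j) w" for j
  have u_wt: "u j \<in> wt (L k)" for j by (induction j) (simp_all add: u_def w R)
  have u_Suc: "act x t (u (Suc j)) = act x e (u j)" for j
    using R(2)[OF u_wt[of j]] by (simp add: u_def)
  have D_t: "act x t (D y) = D (act x t y)" for y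
    by (simp add: D_def act_simps act_commute[OF t])
  have D_e: "D (act x e y) = act x e (D y) + scaleV (\<alpha> h0) (act x t y)" for y
  proof -
    have "act (br h0 x) (t * e) y = scaleV (\<alpha> h0) (act x t y)"
      using x h0(1) S.unit_mult[of t] by (simp add: root_def act_g_simps mult.commute)
    thus ?thesis using act_br[of h0 x t e y] by (simp add: D_def act_simps algebra_simps)
  qed
  have D0: "D (u 0) = 0" by (simp add: D_def u_def w)
  \<comment> \<open>This is \<open>[D, R] = \<alpha> h0\<close> iterated. In characteristic zero the
    factors stay nonzero.\<close>
  have DS: "D (u (Suc j)) = scaleV (of_nat (Suc j) * \<alpha> h0) (u j)" for j
  proof (induction j)
    case 0
    have "act x t (D (u (Suc 0)) - scaleV (\<alpha> h0) (u 0)) = 0"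
      by (simp add: act_simps D_t u_Suc D_e D0)
    from inj[OF this] show ?case by simp
  next
    case (Suc j)
    have "act x t (D (u (Suc (Suc j)))) =
        scaleV (of_nat (Suc j) * \<alpha> h0) (act x e (u j)) + scaleV (\<alpha> h0) (act x e (u j))"
      by (simp only: D_t u_Suc D_e Suc act_simps)
    also have "\<dots> = scaleV (of_nat (Suc (Suc j)) * \<alpha> h0) (act x t (u (Suc j)))"
      unfolding u_Suc V.scale_left_distrib[symmetric]
      by (rule arg_cong[where f = "\<lambda>a. scaleV a (act x e (u j))"]) (simp add: algebra_simps)
    finally have "act x t (D (u (Suc (Suc j))) -
        scaleV (of_nat (Suc (Suc j)) * \<alpha> h0) (u (Suc j))) = 0"
      by (simp only: act_simps diff_self)
    from inj[OF this] show ?case by simp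
  qed
  show False
  proof (rule V.no_nilpotent_ladder[OF D A(1), of u "\<lambda>j. of_nat (Suc j) * \<alpha> h0" "\<lambda>_. 0"])
    show "of_nat (Suc j) * \<alpha> h0 \<noteq> 0" for j
      unfolding mult_eq_0_iff of_nat_eq_0_iff using h0(2) by simp
  qed (use u_wt A(2) D0 DS w(2) in \<open>auto simp: u_def\<close>)
qed

text \<open>
  On a common null vector of \<open>x \<otimes> t\<close> and \<open>y \<otimes> t\<close>, the operators \<open>x \<otimes> e\<close> and \<open>y \<otimes> e\<close> act like
  creation operators, with \<open>[x, y] \<otimes> t\<close> as an invertible central charge.
\<close>

lemma nil_bracket_opposite_roots:
  assumes t: "t * t \<in> ann" and x: "root \<alpha> x" "nil x t" and y: "root \<beta> y" "nil y t"
    and opp: "\<And>h. h \<in> H \<Longrightarrow> \<alpha> h + \<beta> h = 0" and k: "br x y \<in> H"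
  shows "nil (br x y) t"
proof (rule ccontr)
  assume not_nil: "\<not> nil (br x y) t"
  define k where "k = br x y"
  have kH: "k \<in> H" using k by (simp add: k_def)
  obtain l0 v0 where l0: "l0 \<in> dual" and v0: "v0 \<in> wt l0" "v0 \<noteq> 0"
    using nonzero_weight_vector .
  obtain A where A: "finite A" "wt l0 \<subseteq> V.span A" using wt_fin_span[OF l0] .
  obtain v1 c where v1: "v1 \<in> wt l0" "v1 \<noteq> 0" "act k t v1 = scaleV c v1"
    by (rule V.eigenvector_exists[OF act_linear[of k t] subspace_wt_space act_H_wt[OF kH] A v0])
  have c: "c \<noteq> 0" using nil_if_kernel[OF t _ v1(2), of k] v1(3) not_nil by (auto simp: k_def)
  note comm = act_commute[OF t]
  \<comment> \<open>The null vector must have some weight and keep the eigenvalue \<open>c\<close>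
    of \<open>k \<otimes> t\<close>, but \<open>x \<otimes> t\<close> and
    \<open>y \<otimes> t\<close> move between weight spaces; hence the union over all
    weights.\<close>
  let ?W = "{v. (\<exists>l\<in>dual. v \<in> wt l) \<and> act k t v = scaleV c v}"
  let ?F = "{act x t, act y t}"
  have shift: "act z t w \<in> ?W" if "root \<gamma> z" "w \<in> ?W" for z \<gamma> w
  proof -
    from that obtain l where "l \<in> dual" "w \<in> wt l" "act k t w = scaleV c w" by blast
    thus ?thesis using act_root_wt[OF that(1), of w l t] add_dual[of l \<gamma>] that(1)
      by (auto simp: root_def comm[of k z] act_simps)
  qed
  obtain v where v: "v \<in> ?W" "v \<noteq> 0" "\<And>T. T \<in> ?F \<Longrightarrow> T v = 0"
  proof (rule V.common_kernel[of ?F ?W v1])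
    show "\<exists>k. (T ^^ k) u = 0" if "T \<in> ?F" for T u
      using that x y by (auto simp: nil_def)
    show "T (T' u) = T' (T u)" if "T \<in> ?F" "T' \<in> ?F" for T T' u
      using that comm by auto
    show "T w \<in> ?W" if "T \<in> ?F" "w \<in> ?W" for T w
      using that(1) shift[OF x(1) that(2)] shift[OF y(1) that(2)] by blast
  qed (use v1 l0 in \<open>auto simp: act_simps\<close>)
  from v(1) obtain l where l: "l \<in> dual" "v \<in> wt l" and kv: "act k t v = scaleV c v" by blast
  have xv: "act x t v = 0" and yv: "act y t v = 0" by (rule v(3); simp)+
  \<comment> \<open>If \<open>\<gamma>\<close> is nonzero, \<open>k \<otimes> t\<close> is not quite
    central: its commutators with \<open>x \<otimes> e\<close> and \<open>y \<otimes> e\<close> are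
    multiples of \<open>x \<otimes> t\<close> and \<open>y \<otimes> t\<close>. The resulting extra
    terms are what the second summand in \<open>no_nilpotent_ladder\<close> is for.\<close>
  define \<gamma> where "\<gamma> = \<alpha> k"
  have kx: "br k x = scaleG \<gamma> x" using x(1) kH by (simp add: root_def \<gamma>_def)
  have "\<beta> k = - \<gamma>" using opp[OF kH] by (simp add: \<gamma>_def eq_neg_iff_add_eq_0 add.commute)
  hence ky: "br k y = scaleG (- \<gamma>) y" using y(1) kH by (simp add: root_def)
  have e: "t * e = t" "e * t = t" using S.unit_mult[of t] by (simp_all add: mult.commute)
  have yx: "br y x = - k" using G.br_antisym[of y x] by (simp add: k_def)
  have xX: "act x t (act x e w) = act x e (act x t w)" for w
    using act_br[of x x t e w] by (simp add: G.br_self act_g_simps)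
  have yY: "act y t (act y e w) = act y e (act y t w)" for w
    using act_br[of y y t e w] by (simp add: G.br_self act_g_simps)
  have yX: "act y t (act x e w) = act x e (act y t w) - act k t w" for w
    using act_br[of y x t e w] by (simp add: yx e act_g_simps algebra_simps)
  have xY: "act x t (act y e w) = act y e (act x t w) + act k t w" for w
    using act_br[of x y t e w] by (simp add: e algebra_simps flip: k_def)
  have kX: "act k t (act x e w) = act x e (act k t w) + scaleV \<gamma> (act x t w)" for w
    using act_br[of k x t e w] by (simp add: kx e act_g_simps algebra_simps)
  have kY: "act k t (act y e w) = act y e (act k t w) - scaleV \<gamma> (act y t w)" for w
    using act_br[of k y t e w] by (simp add: ky e act_g_simps algebra_simps)
  \<comment> \<open>The weight of \<open>z a b\<close> is \<open>l + b \<alpha> + a \<beta>\<close>,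
    so the diagonal stays in one finite-dimensional weight space. In the formulas below, a truncated
    index always comes with a vanishing coefficient.\<close>
  define z where "z a b = (act y e ^^ a) ((act x e ^^ b) v)" for a b
  have z00: "z 0 0 = v" by (simp add: z_def)
  have z0S: "z 0 (Suc b) = act x e (z 0 b)" for b by (simp add: z_def)
  have zS: "z (Suc a) b = act y e (z a b)" for a b by (simp add: z_def)
  have xz0: "act x t (z 0 b) = 0" for b
    by (induction b) (simp_all add: z00 z0S xX xv act_simps)
  have kz0: "act k t (z 0 b) = scaleV c (z 0 b)" for b
    by (induction b) (simp_all add: z00 z0S kX kv xz0 act_simps)
  have yz: "act y t (z a b) = scaleV (- of_nat b * c) (z a (b - 1))" for a b
  proof (induction a)
    case 0
    show ?case
    proof (induction b)
      case (Suc b)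
      have "act x e (act y t (z 0 b)) = scaleV (- of_nat b * c) (z 0 b)"
        unfolding Suc by (cases b) (simp_all only: act_simps z0S diff_Suc_1, simp)
      moreover have "scaleV (- of_nat b * c) u - scaleV c u = scaleV (- of_nat (Suc b) * c) u" for u
        unfolding V.scale_left_diff_distrib[symmetric]
        by (rule arg_cong[where f = "\<lambda>a. scaleV a u"]) (simp add: algebra_simps)
      ultimately show ?case by (simp only: z0S yX kz0 diff_Suc_1)
    qed (simp add: z00 yv)
  next
    case (Suc a)
    thus ?case by (simp add: zS yY act_simps)
  qed
  have kz: "act k t (z a b) =
      scaleV c (z a b) + scaleV (of_nat (a * b) * c * \<gamma>) (z (a - 1) (b - 1))" for a b
  proof (induction a)
    case (Suc a)
    have "scaleV (of_nat (a * b) * c * \<gamma>) (act y e (z (a - 1) (b - 1))) =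
        scaleV (of_nat (a * b) * c * \<gamma>) (z a (b - 1))"
      by (cases a) (simp_all add: zS)
    thus ?case
      by (simp add: zS kY Suc yz act_simps algebra_simps V.scale_left_distrib)
  qed (simp add: kz0)
  \<comment> \<open>\<open>a choose 2\<close> is the sum of the factors \<open>a'\<close> from
    \<open>kz\<close> over \<open>a' < a\<close>, collected while \<open>x \<otimes> t\<close>
    passes \<open>a\<close> copies of \<open>y \<otimes> e\<close>.\<close>
  have xz: "act x t (z a b) = scaleV (of_nat a * c) (z (a - 1) b) +
      scaleV (of_nat (a choose 2) * of_nat b * c * \<gamma>) (z (a - 2) (b - 1))" for a b
  proof (induction a)
    case (Suc a)
    have 1: "scaleV (of_nat a * c) (act y e (z (a - 1) b)) = scaleV (of_nat a * c) (z a b)"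
      by (cases a) (simp_all add: zS)
    have 2: "scaleV (of_nat (a choose 2) * of_nat b * c * \<gamma>) (act y e (z (a - 2) (b - 1))) =
        scaleV (of_nat (a choose 2) * of_nat b * c * \<gamma>) (z (a - 1) (b - 1))"
    proof (cases "a < 2")
      case False
      then obtain a' where "a = Suc (Suc a')" by (metis add_2_eq_Suc le_Suc_ex not_less)
      thus ?thesis by (simp add: zS)
    qed (simp add: binomial_eq_0)
    have choose: "Suc a choose 2 = a + (a choose 2)" by (simp add: numeral_2_eq_2)
    show ?case
      unfolding zS xY Suc kz act_simps 1 2 choose
      by (simp add: V.scale_left_distrib algebra_simps)
  qed (simp add: xz0 numeral_2_eq_2)
  \<comment> \<open>Up to the \<open>\<gamma>\<close> terms, \<open>x \<otimes> t\<close> lowers the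
    first index and \<open>y \<otimes> t\<close> the second, so \<open>D\<close> goes one step down
    the diagonal; the \<open>\<gamma>\<close> terms go two steps down.\<close>
  define D where "D w = act y t (act x t w)" for w
  have D: "Vector_Spaces.linear scaleV scaleV D"
    by (rule V.linearI) (simp_all add: D_def act_simps)
  obtain A' where A': "finite A'" "wt l \<subseteq> V.span A'" using wt_fin_span[OF l(1)] .
  have "act h e (z a b) = scaleV (l h + of_nat b * \<alpha> h + of_nat a * \<beta> h) (z a b)"
    if h: "h \<in> H" for h a b
  proof (induction a)
    case 0
    show ?case
    proof (induction b)
      case 0
      show ?case using l(2) h by (simp add: z00 wt_space_def)
    next
      case (Suc b)
      thus ?case using act_root_shift[OF x(1) h Suc, of e] by (simp add: z0S algebra_simps)
    qed
  next
    case (Suc a)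
    show ?case using act_root_shift[OF y(1) h Suc, of e] by (simp add: zS algebra_simps)
  qed
  moreover have "l h + of_nat a * \<alpha> h + of_nat a * \<beta> h = l h" if "h \<in> H" for a h
    using opp[OF that] by (simp add: add.assoc flip: distrib_left)
  ultimately have z_wt: "z a a \<in> wt l" for a by (simp add: wt_space_def)
  show False
  proof (rule V.no_nilpotent_ladder[OF D A'(1), of "\<lambda>j. z j j"
        "\<lambda>j. - (of_nat (Suc j) * of_nat (Suc j) * c * c)"
        "\<lambda>j. - (of_nat (Suc j choose 2) * of_nat (Suc j) * of_nat j * c * c * \<gamma>)"])
    show "range (\<lambda>j. z j j) \<subseteq> V.span A'" using z_wt A'(2) by blast
    show "z 0 0 \<noteq> 0" "D (z 0 0) = 0" using v(2) by (simp_all add: D_def z00 xv act_simps)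
    show "- (of_nat (Suc j) * of_nat (Suc j) * c * c) \<noteq> 0" for j
      unfolding neg_equal_0_iff_equal mult_eq_0_iff of_nat_eq_0_iff using c by simp
    show "D (z (Suc j) (Suc j)) = scaleV (- (of_nat (Suc j) * of_nat (Suc j) * c * c)) (z j j) +
        scaleV (- (of_nat (Suc j choose 2) * of_nat (Suc j) * of_nat j * c * c * \<gamma>))
          (z (j - 1) (j - 1))" for j
      by (simp add: D_def xz yz act_simps mult_ac del: of_nat_Suc)
  qed simp
qed

text \<open>Nilpotent elements form a subspace, and brackets of root vectors span the Lie algebra.
  Such a bracket has weight \<open>\<alpha> + \<beta>\<close>. If this is nonzero,
  \<open>nil_root\<close> applies. Otherwise the bracket centralises \<open>H\<close>, hence lies in
  \<open>H\<close>, and comes either from opposite nonzero roots or from two elements of the abelian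
  \<open>H\<close>.\<close>

lemma nil_all:
  assumes t: "t * t \<in> ann"
  shows "nil x t"
proof -
  let ?N = "{x. nil x t}"
  note N = subspace_nil[OF t]
  have roots: "br x y \<in> ?N" if x: "root \<alpha> x" and y: "root \<beta> y" for \<alpha> x \<beta> y
  proof (cases "\<exists>h\<in>H. \<alpha> h + \<beta> h \<noteq> 0")
    case True
    then obtain h0 where h0: "h0 \<in> H" "\<alpha> h0 + \<beta> h0 \<noteq> 0" by blast
    have "root (\<lambda>h\<in>H. \<alpha> h + \<beta> h) (br x y)"
      using x y add_dual[of \<alpha> \<beta>]
      by (auto simp: root_def G.br_br[of _ x y] G.br_simps G.scale_left_distrib)
    thus ?thesis using nil_root[OF t _ h0(1)] h0 by simp
  next
    case False
    hence opp: "\<alpha> h + \<beta> h = 0" if "h \<in> H" for h using that by blast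
    have "br h (br x y) = 0" if "h \<in> H" for h
      using x y that opp[OF that]
      by (simp add: root_def G.br_br[of h x y] G.br_simps flip: G.scale_left_distrib)
    hence k: "br x y \<in> H" by (rule centralizer_H)
    show ?thesis
    proof (cases "\<exists>h\<in>H. \<alpha> h \<noteq> 0")
      case True
      then obtain h0 where h0: "h0 \<in> H" "\<alpha> h0 \<noteq> 0" by blast
      hence "\<beta> h0 \<noteq> 0" using opp[OF h0(1)] by auto
      thus ?thesis
        using nil_bracket_opposite_roots[OF t x nil_root[OF t x h0] y nil_root[OF t y h0(1)] opp k]
        by simp
    next
      case False
      hence "br h x = 0" "br h y = 0" if "h \<in> H" for h
        using x y opp[OF that] that by (auto simp: root_def)
      hence "x \<in> H" "y \<in> H" using centralizer_H by blast+
      thus ?thesis using H_abelian G.subspace_0[OF N] by simp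
    qed
  qed
  have "br x y \<in> ?N" for x y
  proof -
    have "G.span {x. \<exists>\<alpha>. root \<alpha> x} \<subseteq> {y. br x y \<in> ?N}" if x: "root \<alpha> x" for \<alpha> x
      using roots[OF x] G.subspace_0[OF N] G.subspace_add[OF N] G.subspace_scale[OF N]
      by (intro G.span_minimal G.subspaceI) (auto simp: G.br_simps)
    hence *: "br x y \<in> ?N" if "root \<alpha> x" for \<alpha> x y
      using that roots_span by blast
    have "G.span {x. \<exists>\<alpha>. root \<alpha> x} \<subseteq> {x. br x y \<in> ?N}"
      using * G.subspace_0[OF N] G.subspace_add[OF N] G.subspace_scale[OF N]
      by (intro G.span_minimal G.subspaceI) (auto simp: G.br_simps)
    thus ?thesis using roots_span by blast
  qed
  hence "G.span {br x y | x y. True} \<subseteq> ?N" by (intro G.span_minimal N) blast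
  thus ?thesis using span_brackets by blast
qed

text \<open>The joint kernel of finitely many maps of finite rank has finite codimension, so
  finitely many elements represent \<open>Q\<close> modulo it. \<open>Q\<close> is arbitrary because
  the induction passes to the kernel of the first map.\<close>

lemma finite_reduction:
  fixes fs :: "('s \<Rightarrow> 'v) list"
  assumes "\<And>f. f \<in> set fs \<Longrightarrow> Vector_Spaces.linear scaleS scaleV f"
    and "\<And>f. f \<in> set fs \<Longrightarrow> \<exists>A. finite A \<and> range f \<subseteq> V.span A"
    and "S.subspace Q"
  shows "\<exists>R. finite R \<and> R \<subseteq> Q \<and> (\<forall>r\<in>Q. \<exists>r'\<in>S.span R. \<forall>f\<in>set fs. f r = f r')"
  using assms
proof (induction fs arbitrary: Q)
  case Nil
  show ?case by (intro exI[of _ "{}"]) simp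
next
  case (Cons f fs)
  interpret f: module_hom scaleS scaleV f
    using Cons.prems(1)[of f] by (simp add: linear_iff_module_hom)
  obtain A where A: "finite A" "range f \<subseteq> V.span A" using Cons.prems(2)[of f] by auto
  have "f ` Q \<subseteq> V.span A" using A(2) by blast
  then obtain C where C: "finite C" "V.span C = f ` Q"
    using V.fin_dim_basis[OF f.subspace_image[OF Cons.prems(3)] _ A(1)] by metis
  have "C \<subseteq> f ` Q" using C(2) V.span_superset[of C] by simp
  then obtain R0 where R0: "R0 \<subseteq> Q" "finite R0" "C = f ` R0"
    using finite_subset_image[OF C(1)] by metis
  let ?Q = "Q \<inter> {r. f r = 0}"
  have "\<exists>R. finite R \<and> R \<subseteq> ?Q \<and> (\<forall>r\<in>?Q. \<exists>r'\<in>S.span R. \<forall>f\<in>set fs. f r = f r')"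
    using Cons.prems by (intro Cons.IH S.subspace_inter f.subspace_kernel) auto
  then obtain R1 where R1: "finite R1" "R1 \<subseteq> ?Q"
    "\<And>r. r \<in> ?Q \<Longrightarrow> \<exists>r'\<in>S.span R1. \<forall>f\<in>set fs. f r = f r'" by blast
  have "\<exists>r'\<in>S.span (R0 \<union> R1). \<forall>g\<in>set (f # fs). g r = g r'" if r: "r \<in> Q" for r
  proof -
    have "f r \<in> f ` S.span R0" using r C(2) R0(3) f.span_image[of R0] by blast
    then obtain r0 where r0: "r0 \<in> S.span R0" "f r = f r0" by blast
    have "r0 \<in> Q" using r0(1) S.span_minimal[OF R0(1) Cons.prems(3)] by blast
    hence "r - r0 \<in> ?Q" using r r0(2) S.subspace_diff[OF Cons.prems(3)] by (simp add: f.diff)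
    then obtain r1 where r1: "r1 \<in> S.span R1" "\<And>g. g \<in> set fs \<Longrightarrow> g (r - r0) = g r1"
      using R1(3) by blast
    have "r1 \<in> ?Q"
      using r1(1) S.span_minimal[OF R1(2)] Cons.prems(3) f.subspace_kernel S.subspace_inter by blast
    have "g r = g (r0 + r1)" if "g \<in> set (f # fs)" for g
    proof (cases "g = f")
      case True
      thus ?thesis using r0(2) \<open>r1 \<in> ?Q\<close> by (simp add: f.add)
    next
      case False
      hence g: "g \<in> set fs" using that by simp
      have "Vector_Spaces.linear scaleS scaleV g" using Cons.prems(1) that by blast
      note lin = linear_simps[OF this]
      have "g r - g r0 = g r1" using r1(2)[OF g] lin(4) by simp
      thus ?thesis by (simp add: lin(1) diff_eq_eq add.commute)
    qed
    moreover have "r0 + r1 \<in> S.span (R0 \<union> R1)"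
      using r0(1) r1(1) S.span_mono[of R0 "R0 \<union> R1"] S.span_mono[of R1 "R0 \<union> R1"]
      by (intro S.span_add) auto
    ultimately show ?thesis by blast
  qed
  thus ?case using R0 R1 by (intro exI[of _ "R0 \<union> R1"]) auto
qed

end

section \<open>Vanishing of square-zero elements\<close>

context weight_rep
begin

text \<open>A basis of root vectors sends one weight space into finitely many others, all of finite
  dimension. Hence \<open>finite_reduction\<close> cuts the family \<open>x \<otimes> t r\<close>
  down to finitely many operators, and a suitable common null vector of these is one for the whole
  family.\<close>

lemma square_in_ann:
  assumes t: "t * t \<in> ann"
  shows "t \<in> ann"
proof -
  obtain l v where l: "l \<in> dual" and v: "v \<in> wt l" "v \<noteq> 0" using nonzero_weight_vector .
  obtain A where A: "finite A" "wt l \<subseteq> V.span A" using wt_fin_span[OF l] .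
  obtain BV where BV: "finite BV" "V.span BV = wt l"
    using V.fin_dim_basis[OF subspace_wt_space A(2,1)] by metis
  obtain A' where A': "finite A'" "G.span A' = UNIV" using g_fin .
  obtain BG where BG: "BG \<subseteq> {x. \<exists>\<alpha>. root \<alpha> x}" "G.independent BG"
      "{x. \<exists>\<alpha>. root \<alpha> x} \<subseteq> G.span BG"
    by (rule G.maximal_independent_subset)
  have BG_span: "G.span BG = UNIV"
    using G.span_minimal[OF BG(3) G.subspace_span] unfolding roots_span by blast
  have BG_fin: "finite BG" using G.independent_span_bound[OF A'(1) BG(2)] A'(2) by simp
  have sq: "(t * r) * (t * r') \<in> ann" for r r'
    using ann_mult[OF t, of "r * r'"] by (simp add: ac_simps)
  have lin: "Vector_Spaces.linear scaleS scaleV (\<lambda>r. act x (t * r) w)" for x w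
  proof -
    have sc: "t * scaleS c r = scaleS c (t * r)" for c r
      using S.scale_mult_left[of c r t] by (simp add: mult.commute)
    show ?thesis
      using S.vector_space_axioms V.vector_space_axioms
      by (simp add: Vector_Spaces.linear_iff act_s_simps distrib_left sc)
  qed
  define P where "P = (\<lambda>(x, w) r. act x (t * r) w) ` (BG \<times> BV)"
  have "finite P" using BG_fin BV(1) by (simp add: P_def)
  then obtain fs where fs: "set fs = P" using finite_list by blast
  have "\<exists>R. finite R \<and> R \<subseteq> UNIV \<and> (\<forall>r\<in>UNIV. \<exists>r'\<in>S.span R. \<forall>f\<in>set fs. f r = f r')"
  proof (rule finite_reduction)
    fix f assume "f \<in> set fs"
    then obtain x w where xw: "x \<in> BG" "w \<in> BV" and f: "f = (\<lambda>r. act x (t * r) w)"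
      by (auto simp: fs P_def)
    show "Vector_Spaces.linear scaleS scaleV f" using lin by (simp add: f)
    obtain \<alpha> where \<alpha>: "root \<alpha> x" using BG(1) xw(1) by blast
    have "w \<in> wt l" using xw(2) BV(2) V.span_base by blast
    hence sub: "range f \<subseteq> wt (\<lambda>h\<in>H. l h + \<alpha> h)" using act_root_wt[OF \<alpha>] by (auto simp: f)
    have "(\<lambda>h\<in>H. l h + \<alpha> h) \<in> dual" using l \<alpha> by (simp add: root_def add_dual)
    then obtain A where "finite A" "wt (\<lambda>h\<in>H. l h + \<alpha> h) \<subseteq> V.span A" by (rule wt_fin_span)
    thus "\<exists>A. finite A \<and> range f \<subseteq> V.span A" using sub by blast
  qed simp
  then obtain R where "finite R \<and> R \<subseteq> UNIV \<and>
      (\<forall>r\<in>UNIV. \<exists>r'\<in>S.span R. \<forall>f\<in>set fs. f r = f r')" ..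
  hence R: "finite R" "\<exists>r'\<in>S.span R. \<forall>f\<in>set fs. f r = f r'" for r by simp_all
  text \<open>The finitely many operators \<open>x \<otimes> t r'\<close> with \<open>r' \<in> R\<close> determine all \<open>x \<otimes> t r\<close> on
    the subspace \<open>W\<close>.\<close>
  define W where "W = {w. \<forall>x r r'. (\<forall>f\<in>set fs. f r = f r') \<longrightarrow> act x (t * r) w = act x (t * r') w}"
  have "act x (t * r) v = act x (t * r') v" if "\<forall>f\<in>set fs. f r = f r'" for x r r'
  proof -
    have 1: "act x (t * r) w = act x (t * r') w" if "x \<in> BG" "w \<in> BV" for x w
      using \<open>\<forall>f\<in>set fs. f r = f r'\<close> that by (auto simp: fs P_def)
    have "V.span BV \<subseteq> {w. act x (t * r) w = act x (t * r') w}" if "x \<in> BG" for x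
      by (intro V.span_minimal V.subspaceI) (use 1[OF that] in \<open>auto simp: act_simps\<close>)
    hence 2: "act x (t * r) v = act x (t * r') v" if "x \<in> BG" for x
      using that v(1) BV(2) by blast
    have "G.span BG \<subseteq> {x. act x (t * r) v = act x (t * r') v}"
      by (intro G.span_minimal G.subspaceI) (use 2 in \<open>auto simp: act_g_simps\<close>)
    thus ?thesis using BG_span by blast
  qed
  hence vW: "v \<in> W" by (auto simp: W_def)
  let ?F = "(\<lambda>(x, r). act x (t * r)) ` (BG \<times> R)"
  obtain w where w: "w \<in> W" "w \<noteq> 0" "\<And>T. T \<in> ?F \<Longrightarrow> T w = 0"
  proof (rule V.common_kernel[of ?F W v])
    show "finite ?F" using BG_fin R(1) by simp
    show "T 0 = 0" if "T \<in> ?F" for T using that by (auto simp: act_simps)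
    show "\<exists>k. (T ^^ k) u = 0" if "T \<in> ?F" for T u
      using that nil_all[OF sq] by (auto simp: nil_def)
    show "T (T' u) = T' (T u)" if "T \<in> ?F" "T' \<in> ?F" for T T' u
      using that act_commute[OF sq] by auto
    show "T w \<in> W" if "T \<in> ?F" "w \<in> W" for T w
    proof -
      from that(1) obtain y s where T: "T = act y (t * s)" by auto
      have comm: "act x (t * r) (T w) = T (act x (t * r) w)" for x r
        unfolding T by (rule act_commute[OF sq])
      show ?thesis unfolding W_def mem_Collect_eq comm
        using that(2) unfolding W_def mem_Collect_eq by (intro allI impI arg_cong[where f = T]) blast
    qed
    show "v \<in> W" "v \<noteq> 0" by (rule vW, rule v)
  qed (rule that)
  have BR: "act x (t * r) w = 0" if "x \<in> BG" "r \<in> R" for x r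
    using that by (intro w(3)) (auto intro: rev_image_eqI[of "(x, r)"])
  have "act x (t * r) w = 0" for x r
  proof -
    have span_R: "S.span R \<subseteq> {r. act x (t * r) w = 0}" if "x \<in> BG" for x
      using BR[OF that] linear_simps[OF lin[of x w]]
      by (intro S.span_minimal S.subspaceI) (simp_all add: subset_eq)
    obtain r' where r': "r' \<in> S.span R" "\<forall>f\<in>set fs. f r = f r'" using R(2) by blast
    have "act x (t * r) w = act x (t * r') w" for x
      using w(1) r'(2) unfolding W_def by blast
    hence "BG \<subseteq> {x. act x (t * r) w = 0}" using span_R r'(1) by auto
    hence "G.span BG \<subseteq> {x. act x (t * r) w = 0}"
      by (rule G.span_minimal) (auto intro!: G.subspaceI simp: act_g_simps)
    thus ?thesis using BG_span by blast
  qed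
  hence w0: "w \<in> {w. \<forall>x r. act x (t * r) w = 0}" by blast
  \<comment> \<open>\<open>[x \<otimes> t r, y \<otimes> s] = [x, y] \<otimes> t (r s)\<close>
    belongs to the same family of operators.\<close>
  have "invariant {w. \<forall>x r. act x (t * r) w = 0}"
    unfolding invariant_def
  proof (intro conjI allI ballI CollectI)
    show "V.subspace {w. \<forall>x r. act x (t * r) w = 0}"
      by (rule V.subspaceI) (auto simp: act_simps)
    fix y s u x r assume "u \<in> {w. \<forall>x r. act x (t * r) w = 0}"
    hence u: "act x (t * r) u = 0" for x r by blast
    have "t * r * s = t * (r * s)" by (simp add: mult.assoc)
    thus "act x (t * r) (act y s u) = 0"
      using act_br[of x y "t * r" s u] by (simp add: u act_simps)
  qed
  hence "{w. \<forall>x r. act x (t * r) w = 0} = UNIV" using irr w0 w(2) by blast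
  hence "act x (t * e) u = 0" for x u by blast
  thus ?thesis using S.unit_mult[of t] by (simp add: ann_def mult.commute)
qed

end

section \<open>The kernel of the action\<close>

context simple_current_rep
begin

text \<open>
  For linearly independent \<open>b\<close>, the tuples \<open>x\<close> with \<open>\<Sum>b. x b \<otimes> b\<close> in the kernel form a submodule
  of a power of the adjoint module. By induction, such a tuple is determined by its value at one
  \<open>b\<close>, so the other entries depend on it by operators in the centroid, which are scalars.
\<close>

lemma relation_trivial:
  assumes "finite F"
    and "\<And>c. (\<Sum>b\<in>F. scaleS (c b) b) \<in> ann \<Longrightarrow> \<forall>b\<in>F. c b = 0"
    and "\<And>v. (\<Sum>b\<in>F. act (x b) b v) = 0"
  shows "\<forall>b\<in>F. x b = 0"
  using assms
proof (induction F arbitrary: x rule: finite_induct)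
  case (insert j F)
  note j = insert.hyps
  have indep: "\<forall>b\<in>F. c b = 0" if "(\<Sum>b\<in>F. scaleS (c b) b) \<in> ann" for c
  proof -
    have "(\<Sum>b\<in>F. scaleS ((c(j := 0)) b) b) = (\<Sum>b\<in>F. scaleS (c b) b)"
      using j by (intro sum.cong) auto
    hence "\<forall>b\<in>insert j F. (c(j := 0)) b = 0"
      using that j by (intro insert.prems(1)) simp
    thus ?thesis using j by (auto split: if_splits)
  qed
  define rel where "rel y \<longleftrightarrow> (\<forall>v. (\<Sum>b\<in>insert j F. act (y b) b v) = 0)" for y
  have IH: "\<forall>b\<in>F. y b = 0" if "rel y" "y j = 0" for y
  proof (rule insert.IH[OF indep])
    show "(\<Sum>b\<in>F. act (y b) b v) = 0" for v
      using that j by (simp add: rel_def act_g_simps)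
  qed
  have rel_add: "rel (\<lambda>b. y b + z b)" and rel_diff: "rel (\<lambda>b. y b - z b)"
    if "rel y" "rel z" for y z
    using that unfolding rel_def by (simp_all only: act_g_simps sum.distrib sum_subtractf) simp_all
  have rel_scale: "rel (\<lambda>b. scaleG c (y b))" if "rel y" for c y
    using that unfolding rel_def by (simp only: act_g_simps V.scale_sum_right[symmetric]) simp
  have rel_br: "rel (\<lambda>b. br z (y b))" if "rel y" for y z
    unfolding rel_def
  proof
    fix v
    have "(\<Sum>b\<in>insert j F. act (br z (y b)) b v) =
        act z e (\<Sum>b\<in>insert j F. act (y b) b v) - (\<Sum>b\<in>insert j F. act (y b) b (act z e v))"
      by (simp only: act_br_e act_simps sum_subtractf)
    also have "\<dots> = 0" using that by (simp only: rel_def act_simps) simp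
    finally show "(\<Sum>b\<in>insert j F. act (br z (y b)) b v) = 0" .
  qed
  have unique: "\<forall>b\<in>F. y b = z b" if "rel y" "rel z" "y j = z j" for y z
    using IH[OF rel_diff[OF that(1,2)]] that(3) by simp
  \<comment> \<open>The projection of all relations to the entry at \<open>j\<close> is an ideal by
    \<open>rel_br\<close>. If it is zero, the induction hypothesis finishes; if it is everything,
    each \<open>y\<close> extends to a unique relation \<open>Y y\<close>.\<close>
  let ?N = "{y j | y. rel y}"
  have "G.lie_ideal ?N"
    unfolding G.lie_ideal_def
  proof (intro conjI G.subspaceI allI ballI)
    show "0 \<in> ?N" by (intro CollectI exI[of _ "\<lambda>_. 0"]) (simp add: rel_def act_g_simps)
    fix u assume "u \<in> ?N"
    then obtain y where y: "rel y" "u = y j" by blast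
    show "scaleG c u \<in> ?N" for c
      using rel_scale[OF y(1), of c] y(2) by (intro CollectI exI[of _ "\<lambda>b. scaleG c (y b)"]) simp
    show "br z u \<in> ?N" for z
      using rel_br[OF y(1), of z] y(2) by (intro CollectI exI[of _ "\<lambda>b. br z (y b)"]) simp
    fix w assume "w \<in> ?N"
    then obtain y' where "rel y'" "w = y' j" by blast
    thus "u + w \<in> ?N"
      using rel_add[OF y(1), of y'] y(2) by (intro CollectI exI[of _ "\<lambda>b. y b + y' b"]) simp
  qed
  hence "?N = {0} \<or> ?N = UNIV" using simple unfolding G.simple_def by blast
  thus ?case
  proof
    assume "?N = {0}"
    moreover have "rel x" using insert.prems(2) by (simp add: rel_def)
    ultimately have "x j = 0" by blast
    with IH[OF \<open>rel x\<close>] show ?thesis by simp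
  next
    assume N: "?N = UNIV"
    have "\<exists>Y. rel Y \<and> Y j = y" for y
    proof -
      have "y \<in> ?N" unfolding N by simp
      thus ?thesis by blast
    qed
    then obtain Y where Y: "\<And>y. rel (Y y)" "\<And>y. Y y j = y" by metis
    \<comment> \<open>Schur's lemma: \<open>Y y i\<close> is linear in \<open>y\<close> and commutes
      with every \<open>br z\<close>, so an eigenspace of it is a nonzero ideal.\<close>
    have scalar: "\<exists>c. \<forall>y. Y y i = scaleG c y" if i: "i \<in> F" for i
    proof -
      have add: "Y (y + z) i = Y y i + Y z i" for y z
        using unique[OF Y(1) rel_add[OF Y(1) Y(1)], of "y + z" y z] i by (simp add: Y(2))
      have scale: "Y (scaleG c y) i = scaleG c (Y y i)" for c y
        using unique[OF Y(1) rel_scale[OF Y(1)], of "scaleG c y" c y] i by (simp add: Y(2))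
      have bracket: "Y (br z y) i = br z (Y y i)" for z y
        using unique[OF Y(1) rel_br[OF Y(1)], of "br z y" z y] i by (simp add: Y(2))
      have lin: "Vector_Spaces.linear scaleG scaleG (\<lambda>y. Y y i)"
        by (rule G.linearI) (simp_all add: add scale)
      have GA: "alg_closed_vector_space scaleG"
        using G.vector_space_axioms by (simp add: alg_closed_vector_space_def)
      obtain A where A: "finite A" "G.span A = UNIV" using g_fin .
      obtain g0 g1 where "br g0 g1 \<noteq> 0" using simple unfolding G.simple_def by blast
      then obtain w c where w: "w \<noteq> 0" "Y w i = scaleG c w"
        using alg_closed_vector_space.eigenvector_exists[OF GA lin G.subspace_UNIV _ A(1), of "br g0 g1"]
          A(2) by auto
      let ?K = "{y. Y y i = scaleG c y}"
      have "G.lie_ideal ?K"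
        unfolding G.lie_ideal_def
        by (auto intro!: G.subspaceI
            simp: add bracket scale linear_simps[OF lin] G.br_simps G.scale_right_distrib mult.commute)
      hence "?K = {0} \<or> ?K = UNIV" using simple unfolding G.simple_def by blast
      thus ?thesis using w by blast
    qed
    then obtain c where c: "\<And>i y. i \<in> F \<Longrightarrow> Y y i = scaleG (c i) y" by metis
    \<comment> \<open>With the entry 1 at \<open>j\<close>, the relation \<open>Y y\<close> says
      that \<open>y \<otimes> (\<Sum> c' b b)\<close> acts as zero for every \<open>y\<close>; so a
      combination with a nonzero coefficient lies in \<open>ann\<close>, against
      independence.\<close>
    define c' where "c' = c(j := 1)"
    have c': "Y y b = scaleG (c' b) y" if "b \<in> insert j F" for y b
      using that c Y(2) j by (auto simp: c'_def)
    have "act y (\<Sum>b\<in>insert j F. scaleS (c' b) b) v = 0" for y v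
    proof -
      have "act y (\<Sum>b\<in>insert j F. scaleS (c' b) b) v = (\<Sum>b\<in>insert j F. act (Y y b) b v)"
        by (simp only: act_s_simps) (intro sum.cong, auto simp: c' act_g_simps)
      thus ?thesis using Y(1)[of y] by (simp only: rel_def)
    qed
    hence "(\<Sum>b\<in>insert j F. scaleS (c' b) b) \<in> ann" unfolding ann_def by blast
    from insert.prems(1)[OF this] have False by (simp add: c'_def)
    thus ?thesis ..
  qed
qed simp

end

section \<open>Coordinates in the tensor product\<close>

lemma poly_mapping_single_induct:
  fixes f :: "'a \<Rightarrow>\<^sub>0 'b::comm_monoid_add"
  assumes "P 0" "\<And>p a. P (Poly_Mapping.single p a)" "\<And>f g. P f \<Longrightarrow> P g \<Longrightarrow> P (f + g)"
  shows "P f"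
proof -
  have "P (\<Sum>p\<in>A. Poly_Mapping.single p (Poly_Mapping.lookup f p))" if "finite A" for A
    using that by (induction A rule: finite_induct) (auto intro: assms)
  moreover have
    "(\<Sum>p\<in>Poly_Mapping.keys f. Poly_Mapping.single p (Poly_Mapping.lookup f p)) = f"
    by (rule poly_mapping_eqI) (auto simp: lookup_sum lookup_single when_def in_keys_iff)
  ultimately show ?thesis using finite_keys[of f] by metis
qed

context current_algebra
begin

lemma pure_in_tensor_space: "pure x s \<in> tensor_space"
  by (simp add: pure_def cls_def tensor_space_def quotientI)

lemma cls_in_tensor_space: "cls f \<in> tensor_space"
  by (simp add: cls_def tensor_space_def quotientI)

lemma tensor_space_cls: "A \<in> tensor_space \<Longrightarrow> \<exists>f. A = cls f"
  by (auto simp: tensor_space_def cls_def elim!: quotientE)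

lemma cls_eqI: "f - g \<in> relators \<Longrightarrow> cls f = cls g"
  by (simp add: cls_eq_iff free.span_base)

lemma cls_single:
  "cls (Poly_Mapping.single (x + y, s) 1) =
    cls (Poly_Mapping.single (x, s) 1 + Poly_Mapping.single (y, s) 1)"
  "cls (Poly_Mapping.single (x, r + s) 1) =
    cls (Poly_Mapping.single (x, r) 1 + Poly_Mapping.single (x, s) 1)"
  "cls (Poly_Mapping.single (scaleG c x, s) 1) = cls (Poly_Mapping.single (x, s) c)"
  "cls (Poly_Mapping.single (x, scaleS c s) 1) = cls (Poly_Mapping.single (x, s) c)"
  by (rule cls_eqI, unfold relators_def diff_diff_eq[symmetric], blast)+

lemma cls_add_cong: "cls f = cls f' \<Longrightarrow> cls g = cls g' \<Longrightarrow> cls (f + g) = cls (f' + g')"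
  by (simp flip: tensor_add_cls)

lemma cls_sum_cong:
  assumes "\<And>b. b \<in> F \<Longrightarrow> cls (f b) = cls (g b)"
  shows "cls (sum f F) = cls (sum g F)"
  using assms
proof (induction F rule: infinite_finite_induct)
  case (insert b F)
  have "cls (f b + sum f F) = cls (g b + sum g F)"
    by (rule cls_add_cong) (use insert.prems insert.IH in simp_all)
  thus ?case using insert.hyps by simp
qed simp_all

lemma cls_single_zero: "cls (Poly_Mapping.single (0, s) 1) = cls 0"
  using cls_single(3)[of 0 0 s] by simp

lemma pure_in_tensor_sub: "s \<in> P \<Longrightarrow> pure x s \<in> tensor_sub P"
  unfolding tensor_sub_def pure_def
  by (intro CollectI exI[of _ "Poly_Mapping.single (x, s) 1"]) auto

text \<open>Apply \<open>f \<otimes> id\<close> for a functional with \<open>f x0 = 1\<close>: it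
  sends \<open>x0 \<otimes> s\<close> to \<open>s\<close> and \<open>tensor_sub P\<close> into
  \<open>P\<close>. On representatives this is \<open>\<Psi>\<close>, which kills
  \<open>relators\<close>. The lemma is the source of the uniqueness of \<open>P\<close>.\<close>

lemma tensor_subD:
  assumes P: "S.ring_ideal P" and nz: "\<exists>x::'g. x \<noteq> 0" and s: "\<And>x. pure x s \<in> tensor_sub P"
  shows "s \<in> P"
proof -
  obtain x0 :: 'g where x0: "x0 \<noteq> 0" using nz by blast
  have "vector_space ((*) :: 'k \<Rightarrow> 'k \<Rightarrow> 'k)"
    by unfold_locales (simp_all add: algebra_simps)
  hence pair: "vector_space_pair scaleG ((*) :: 'k \<Rightarrow> 'k \<Rightarrow> 'k)"
    using G.vector_space_axioms by (simp add: vector_space_pair_def)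
  obtain f where f: "Vector_Spaces.linear scaleG (*) f" "f x0 = (1 :: 'k)"
    using vector_space_pair.linear_independent_extend[OF pair, of "{x0}" "\<lambda>_. 1"] x0 by auto
  note lin = linear_simps[OF f(1)]
  define \<Psi> where "\<Psi> h = (\<Sum>p\<in>Poly_Mapping.keys h. scaleS (Poly_Mapping.lookup h p * f (fst p)) (snd p))"
    for h :: "'g \<times> 's \<Rightarrow>\<^sub>0 'k"
  have sup: "\<Psi> h = (\<Sum>p\<in>A. scaleS (Poly_Mapping.lookup h p * f (fst p)) (snd p))"
    if "finite A" "Poly_Mapping.keys h \<subseteq> A" for h A
    unfolding \<Psi>_def by (intro sum.mono_neutral_left) (use that in \<open>auto simp: in_keys_iff\<close>)
  have add: "\<Psi> (h + h') = \<Psi> h + \<Psi> h'" for h h'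
  proof -
    let ?A = "Poly_Mapping.keys h \<union> Poly_Mapping.keys h'"
    have "\<Psi> (h + h') =
        (\<Sum>p\<in>?A. scaleS (Poly_Mapping.lookup (h + h') p * f (fst p)) (snd p))"
      by (rule sup) (use Poly_Mapping.keys_add[of h h'] in auto)
    moreover have "\<Psi> h = (\<Sum>p\<in>?A. scaleS (Poly_Mapping.lookup h p * f (fst p)) (snd p))"
      by (rule sup) auto
    moreover have "\<Psi> h' = (\<Sum>p\<in>?A. scaleS (Poly_Mapping.lookup h' p * f (fst p)) (snd p))"
      by (rule sup) auto
    ultimately show ?thesis
      by (simp only: lookup_add distrib_right S.scale_left_distrib sum.distrib)
  qed
  have scale: "\<Psi> (free_scale c h) = scaleS c (\<Psi> h)" for c h
  proof -
    have "\<Psi> (free_scale c h) = (\<Sum>p\<in>Poly_Mapping.keys h.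
        scaleS (Poly_Mapping.lookup (free_scale c h) p * f (fst p)) (snd p))"
      by (rule sup) (use keys_free_scale[of c h] in auto)
    thus ?thesis by (simp add: \<Psi>_def S.scale_sum_right mult.assoc)
  qed
  have single: "\<Psi> (Poly_Mapping.single (x, r) a) = scaleS (a * f x) r" for x r a
  proof -
    have "\<Psi> (Poly_Mapping.single (x, r) a) = (\<Sum>p\<in>{(x, r)}.
        scaleS (Poly_Mapping.lookup (Poly_Mapping.single (x, r) a) p * f (fst p)) (snd p))"
      by (rule sup) auto
    thus ?thesis by simp
  qed
  have zero: "\<Psi> 0 = 0" by (simp add: \<Psi>_def)
  have diff: "\<Psi> (h - h') = \<Psi> h - \<Psi> h'" for h h'
    using add[of "h - h'" h'] by simp
  have "relators \<subseteq> {h. \<Psi> h = 0}"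
  proof
    fix h assume "h \<in> relators"
    thus "h \<in> {h. \<Psi> h = 0}"
      unfolding relators_def
      by (elim UnE CollectE exE)
        (simp_all add: diff single lin S.scale_right_distrib S.scale_left_distrib mult.commute)
  qed
  moreover have "free.subspace {h. \<Psi> h = 0}"
    using zero by (intro free.subspaceI) (simp_all add: add scale)
  ultimately have span: "free.span relators \<subseteq> {h. \<Psi> h = 0}" by (rule free.span_minimal)
  obtain h where h: "pure x0 s = cls h" "Poly_Mapping.keys h \<subseteq> UNIV \<times> P"
    using s[of x0] by (auto simp: tensor_sub_def)
  have "\<Psi> (Poly_Mapping.single (x0, s) 1 - h) = 0"
    using h(1) span unfolding pure_def cls_eq_iff by blast
  hence s_eq: "s = \<Psi> h" by (simp add: diff single f(2))
  \<comment> \<open>\<open>ring_ideal\<close> speaks of products only; a scalar \<open>c\<close>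
    acts as multiplication by \<open>c e\<close>.\<close>
  have scaleP: "scaleS c p \<in> P" if "p \<in> P" for c p
  proof -
    have "scaleS c p = scaleS c e * p" by (simp add: S.scale_mult_left S.unit_mult)
    thus ?thesis using P that by (simp add: S.ring_ideal_def)
  qed
  have sumP: "sum g A \<in> P" if "\<And>a. a \<in> A \<Longrightarrow> g a \<in> P" for g :: "'g \<times> 's \<Rightarrow> 's" and A
    using that P by (induction A rule: infinite_finite_induct) (simp_all add: S.ring_ideal_def)
  have "\<Psi> h \<in> P" unfolding \<Psi>_def
  proof (rule sumP)
    fix p assume "p \<in> Poly_Mapping.keys h"
    hence "snd p \<in> P" using h(2) by auto
    thus "scaleS (Poly_Mapping.lookup h p * f (fst p)) (snd p) \<in> P" by (rule scaleP)
  qed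
  with s_eq show "s \<in> P" by simp
qed

text \<open>For a basis \<open>T\<close> of S this is the view of the tensor product as finitely
  supported families of Lie algebra elements indexed by \<open>T\<close>.\<close>

definition normal_form :: "'s set \<Rightarrow> ('g \<times> 's \<Rightarrow>\<^sub>0 'k) \<Rightarrow> bool" where
  "normal_form T f \<longleftrightarrow> (\<exists>F x. finite F \<and> F \<subseteq> T \<and> cls f = cls (\<Sum>b\<in>F. Poly_Mapping.single (x b, b) 1))"

lemma normal_form_extend:
  assumes "finite F" "F \<subseteq> F'" "finite F'"
  shows "cls (\<Sum>b\<in>F'. Poly_Mapping.single (if b \<in> F then x b else 0, b) 1) =
    cls (\<Sum>b\<in>F. Poly_Mapping.single (x b, b) (1 :: 'k))"
proof -
  have "cls (\<Sum>b\<in>F'. Poly_Mapping.single (if b \<in> F then x b else 0, b) 1) =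
      cls (\<Sum>b\<in>F'. if b \<in> F then Poly_Mapping.single (x b, b) (1 :: 'k) else 0)"
    by (rule cls_sum_cong) (simp add: cls_single_zero)
  also have "(\<Sum>b\<in>F'. if b \<in> F then Poly_Mapping.single (x b, b) (1 :: 'k) else 0) =
      (\<Sum>b\<in>F. Poly_Mapping.single (x b, b) 1)"
    using assms(2,3) by (simp add: sum.If_cases Int_absorb1)
  finally show ?thesis .
qed

lemma normal_form_add:
  assumes "normal_form T f" "normal_form T g" shows "normal_form T (f + g)"
proof -
  obtain F x where F: "finite F" "F \<subseteq> T" "cls f = cls (\<Sum>b\<in>F. Poly_Mapping.single (x b, b) 1)"
    using assms(1) by (auto simp: normal_form_def)
  obtain F' x' where F': "finite F'" "F' \<subseteq> T" "cls g = cls (\<Sum>b\<in>F'. Poly_Mapping.single (x' b, b) 1)"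
    using assms(2) by (auto simp: normal_form_def)
  let ?y = "\<lambda>b. if b \<in> F then x b else 0" and ?y' = "\<lambda>b. if b \<in> F' then x' b else 0"
  have "cls (f + g) = cls ((\<Sum>b\<in>F \<union> F'. Poly_Mapping.single (?y b, b) 1) +
      (\<Sum>b\<in>F \<union> F'. Poly_Mapping.single (?y' b, b) 1))"
    by (rule cls_add_cong; simp only: F(3) F'(3), rule normal_form_extend[symmetric])
      (use F(1) F'(1) in auto)
  also have "\<dots> = cls (\<Sum>b\<in>F \<union> F'. Poly_Mapping.single (?y b + ?y' b, b) 1)"
    unfolding sum.distrib[symmetric] by (rule cls_sum_cong) (rule cls_single(1)[symmetric])
  finally show ?thesis
    unfolding normal_form_def
    by (intro exI[of _ "F \<union> F'"] exI[of _ "\<lambda>b. ?y b + ?y' b"] conjI) (use F(1,2) F'(1,2) in auto)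
qed

lemma normal_form_cls: "cls f = cls g \<Longrightarrow> normal_form T f \<longleftrightarrow> normal_form T g"
  by (simp add: normal_form_def)

lemma normal_form_exists:
  assumes "S.span T = UNIV" shows "normal_form T f"
proof -
  have zero: "normal_form T 0"
    unfolding normal_form_def by (intro exI[of _ "{}"]) simp
  have base: "normal_form T (Poly_Mapping.single (x, b) 1)" if "b \<in> T" for x b
    unfolding normal_form_def by (intro exI[of _ "{b}"] exI[of _ "\<lambda>_. x"]) (use that in simp)
  have single: "normal_form T (Poly_Mapping.single (x, s) 1)" for x s
  proof -
    have "s \<in> S.span T" by (simp add: assms)
    thus ?thesis
    proof (induction s rule: S.span_induct_alt)
      case base
      have "cls (Poly_Mapping.single (x, 0) 1) = cls 0" using cls_single(4)[of x 0 0] by simp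
      thus ?case using zero normal_form_cls by blast
    next
      case (step c b s)
      have "cls (Poly_Mapping.single (x, scaleS c b + s) 1) =
          cls (Poly_Mapping.single (scaleG c x, b) 1 + Poly_Mapping.single (x, s) 1)"
        unfolding cls_single(2) by (rule cls_add_cong) (simp_all only: cls_single(3,4))
      thus ?case
        using normal_form_add[OF base[OF step(1), of "scaleG c x"] step(2)] normal_form_cls by blast
    qed
  qed
  show ?thesis
  proof (induction f rule: poly_mapping_single_induct)
    case (2 p a)
    have "normal_form T (Poly_Mapping.single (scaleG a (fst p), snd p) 1)" by (rule single)
    thus ?case using normal_form_cls[OF cls_single(3)[of a "fst p" "snd p"]] by simp
  qed (use zero normal_form_add in auto)
qed

end

section \<open>The module over tensors and its kernel\<close>

locale simple_current_module = current_algebra_module scaleG br scaleS e scaleV \<phi>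
  for scaleG :: "'k::{alg_closed_field, field_char_0} \<Rightarrow> 'g::ab_group_add \<Rightarrow> 'g"
    and br :: "'g \<Rightarrow> 'g \<Rightarrow> 'g"
    and scaleS :: "'k \<Rightarrow> 's::comm_ring \<Rightarrow> 's"
    and e :: 's
    and scaleV :: "'k \<Rightarrow> 'v::ab_group_add \<Rightarrow> 'v"
    and \<phi> :: "('g, 's, 'k) tensor \<Rightarrow> 'v \<Rightarrow> 'v" +
  assumes fin_g: "fin_dim scaleG (UNIV :: 'g set)" and simple: "G.simple"
begin

lemma \<phi>_cls_add: "\<phi> (cls (f + g)) v = \<phi> (cls f) v + \<phi> (cls g) v"
  using act_add[OF cls_in_tensor_space cls_in_tensor_space, of f g v] by (simp add: tensor_add_cls)

lemma \<phi>_cls_scale: "\<phi> (cls (free_scale c f)) v = scaleV c (\<phi> (cls f) v)"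
  using act_scale[OF cls_in_tensor_space, of c f v] by (simp add: tensor_scale_cls)

lemma \<phi>_cls_zero: "\<phi> (cls 0) v = 0"
  using \<phi>_cls_scale[of 0 0 v] by simp

lemma \<phi>_cls_sum: "\<phi> (cls (sum f F)) v = (\<Sum>b\<in>F. \<phi> (cls (f b)) v)"
  by (induction F rule: infinite_finite_induct) (simp_all add: \<phi>_cls_zero \<phi>_cls_add)

lemma \<phi>_cls_single: "\<phi> (cls (Poly_Mapping.single (x, s) a)) v = scaleV a (\<phi> (pure x s) v)"
  using \<phi>_cls_scale[of a "Poly_Mapping.single (x, s) 1" v] by (simp add: pure_def)

sublocale R: simple_current_rep scaleG br scaleS e scaleV "\<lambda>x s. \<phi> (pure x s)"
proof -
  note lin = linear_simps[OF act_linear[OF pure_in_tensor_space]]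
  note act = act_add act_scale pure_in_tensor_space
  have "pure (x + y) s = tensor_add (pure x s) (pure y s)"
    "pure x (r + s) = tensor_add (pure x r) (pure x s)" for x y r s
    by (simp_all add: pure_def tensor_add_cls cls_single(1,2))
  moreover have "pure (scaleG c x) s = tensor_scale c (pure x s)"
    "pure x (scaleS c s) = tensor_scale c (pure x s)" for c x s
    by (simp_all add: pure_def tensor_scale_cls cls_single(3,4))
  moreover have "\<phi> (pure (br x y) (r * s)) v =
      \<phi> (pure x r) (\<phi> (pure y s) v) - \<phi> (pure y s) (\<phi> (pure x r) v)" for x y r s v
    using act_bracket[OF pure_in_tensor_space pure_in_tensor_space, of x r y s v]
    by (simp add: tensor_bracket_pure)
  ultimately show "simple_current_rep scaleG br scaleS e scaleV (\<lambda>x s. \<phi> (pure x s))"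
    by unfold_locales (simp_all add: lin act fin_g simple)
qed

lemma submoduleI:
  assumes "R.invariant W" shows "submodule W"
  unfolding submodule_def
proof (intro conjI ballI)
  show W: "V.subspace W" using assms by (simp add: R.invariant_def)
  fix A w assume "A \<in> tensor_space" and w: "w \<in> W"
  then obtain f where f: "A = cls f" using tensor_space_cls by blast
  have "\<phi> (cls f) w \<in> W"
  proof (induction f rule: poly_mapping_single_induct)
    case (2 p a)
    have "\<phi> (pure (fst p) (snd p)) w \<in> W" using assms w by (simp add: R.invariant_def)
    thus ?case using \<phi>_cls_single[of "fst p" "snd p" a w] V.subspace_scale[OF W] by simp
  qed (simp_all add: \<phi>_cls_zero \<phi>_cls_add V.subspace_0[OF W] V.subspace_add[OF W])
  thus "\<phi> A w \<in> W" by (simp add: f)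
qed

text \<open>Extend a basis of \<open>ann\<close> to a basis of S and expand a kernel element in it.
  Terms over \<open>ann\<close> act as zero; the remaining basis elements are independent modulo
  \<open>ann\<close>, so \<open>relation_trivial\<close> makes their coefficients vanish.\<close>

lemma act_kernel_eq: "act_kernel = tensor_sub R.ann"
proof
  show "tensor_sub R.ann \<subseteq> act_kernel"
  proof
    fix A assume "A \<in> tensor_sub R.ann"
    then obtain f where f: "A = cls f" "Poly_Mapping.keys f \<subseteq> UNIV \<times> R.ann"
      by (auto simp: tensor_sub_def)
    have "f = (\<Sum>p\<in>Poly_Mapping.keys f. Poly_Mapping.single p (Poly_Mapping.lookup f p))"
      by (rule poly_mapping_eqI) (auto simp: lookup_sum lookup_single when_def in_keys_iff)
    hence "\<phi> (cls f) v = (\<Sum>p\<in>Poly_Mapping.keys f.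
        \<phi> (cls (Poly_Mapping.single p (Poly_Mapping.lookup f p))) v)" for v
      by (metis \<phi>_cls_sum)
    also have "\<dots>v = 0" for v
    proof (rule sum.neutral, rule ballI)
      fix p assume "p \<in> Poly_Mapping.keys f"
      hence "snd p \<in> R.ann" using f(2) by auto
      thus "\<phi> (cls (Poly_Mapping.single p (Poly_Mapping.lookup f p))) v = 0"
        using \<phi>_cls_single[of "fst p" "snd p" "Poly_Mapping.lookup f p" v] by (simp add: R.ann_def)
    qed
    finally show "A \<in> act_kernel" by (simp add: act_kernel_def f(1) cls_in_tensor_space)
  qed
  show "act_kernel \<subseteq> tensor_sub R.ann"
  proof
    fix A assume A: "A \<in> act_kernel"
    then obtain f where f: "A = cls f" using tensor_space_cls by (auto simp: act_kernel_def)
    obtain T0 where T0: "T0 \<subseteq> R.ann" "S.independent T0" "R.ann \<subseteq> S.span T0"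
      by (rule S.maximal_independent_subset)
    obtain T where T: "T0 \<subseteq> T" "S.independent T" "UNIV \<subseteq> S.span T"
      using S.maximal_independent_subset_extend[OF subset_UNIV T0(2)] by metis
    have "normal_form T f" using T(3) by (intro normal_form_exists) blast
    then obtain F x where F: "finite F" "F \<subseteq> T"
      "cls f = cls (\<Sum>b\<in>F. Poly_Mapping.single (x b, b) 1)"
      by (auto simp: normal_form_def)
    let ?F0 = "F \<inter> T0" and ?F1 = "F - T0"
    have x0: "\<forall>b\<in>?F1. x b = 0"
    proof (rule R.relation_trivial)
      show "finite ?F1" using F(1) by simp
      show "(\<Sum>b\<in>?F1. \<phi> (pure (x b) b) v) = 0" for v
      proof -
        have "(\<Sum>b\<in>F. \<phi> (pure (x b) b) v) = \<phi> A v"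
          by (simp add: f F(3) \<phi>_cls_sum pure_def)
        hence "(\<Sum>b\<in>F. \<phi> (pure (x b) b) v) = 0" using A by (simp add: act_kernel_def)
        moreover have "(\<Sum>b\<in>?F1. \<phi> (pure (x b) b) v) = (\<Sum>b\<in>F. \<phi> (pure (x b) b) v)"
        proof (rule sum.mono_neutral_left[OF F(1)])
          show "\<forall>b\<in>F - ?F1. \<phi> (pure (x b) b) v = 0" using T0(1) by (auto simp: R.ann_def)
        qed blast
        ultimately show ?thesis by simp
      qed
      show "\<forall>b\<in>?F1. c b = 0" if c: "(\<Sum>b\<in>?F1. scaleS (c b) b) \<in> R.ann" for c
      proof -
        have "(\<Sum>b\<in>?F1. scaleS (c b) b) \<in> S.span T0" using c T0(3) by blast
        then obtain t r where t: "finite t" "t \<subseteq> T0"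
          "(\<Sum>b\<in>?F1. scaleS (c b) b) = (\<Sum>b\<in>t. scaleS (r b) b)"
          by (auto simp: S.span_explicit)
        \<comment> \<open>Both sides of the relation are merged into one over the basis
          \<open>T\<close>; \<open>t\<close> lies in \<open>T0\<close> and is therefore disjoint
          from \<open>?F1\<close>.\<close>
        define u where "u b = (if b \<in> t then - r b else c b)" for b
        have "(\<Sum>b\<in>?F1 \<union> t. scaleS (u b) b) = (\<Sum>b\<in>?F1. scaleS (u b) b) + (\<Sum>b\<in>t. scaleS (u b) b)"
          using F(1) t(1,2) by (intro sum.union_disjoint) auto
        also have "(\<Sum>b\<in>?F1. scaleS (u b) b) = (\<Sum>b\<in>?F1. scaleS (c b) b)"
          using t(2) by (intro sum.cong) (auto simp: u_def)
        also have "(\<Sum>b\<in>t. scaleS (u b) b) = - (\<Sum>b\<in>t. scaleS (r b) b)"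
          by (simp add: u_def sum_negf)
        finally have "(\<Sum>b\<in>?F1 \<union> t. scaleS (u b) b) = 0" by (simp add: t(3))
        hence "u b = 0" if "b \<in> ?F1" for b
          using S.independentD[OF T(2), of "?F1 \<union> t" u b] F(1,2) t(1,2) T(1) that by auto
        moreover have "u b = c b" if "b \<in> ?F1" for b using t(2) that by (auto simp: u_def)
        ultimately show ?thesis by simp
      qed
    qed
    have "cls f = cls (\<Sum>b\<in>?F0. Poly_Mapping.single (x b, b) 1)"
      unfolding F(3)
    proof -
      have "cls (\<Sum>b\<in>F. Poly_Mapping.single (x b, b) (1 :: 'k)) =
          cls (\<Sum>b\<in>F. Poly_Mapping.single (if b \<in> ?F0 then x b else 0, b) 1)"
        by (rule cls_sum_cong) (use x0 in auto)
      also have "\<dots> = cls (\<Sum>b\<in>?F0. Poly_Mapping.single (x b, b) 1)"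
        by (rule normal_form_extend) (use F(1) in auto)
      finally show "cls (\<Sum>b\<in>F. Poly_Mapping.single (x b, b) (1 :: 'k)) =
          cls (\<Sum>b\<in>?F0. Poly_Mapping.single (x b, b) 1)" .
    qed
    moreover have "Poly_Mapping.keys (\<Sum>b\<in>?F0. Poly_Mapping.single (x b, b) (1 :: 'k)) \<subseteq> UNIV \<times> R.ann"
      using Poly_Mapping.keys_sum[of "\<lambda>b. Poly_Mapping.single (x b, b) (1 :: 'k)" ?F0] T0(1) by fastforce
    ultimately show "A \<in> tensor_sub R.ann" unfolding f tensor_sub_def by blast
  qed
qed

text \<open>The definite description also asks for uniqueness, which holds because
  \<open>tensor_subD\<close> recovers \<open>P\<close> from \<open>tensor_sub P\<close>.\<close>

lemma ideal_of_module_eq: "ideal_of_module = R.ann"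
  unfolding ideal_of_module_def
proof (rule the_equality)
  show "S.ring_ideal R.ann \<and> act_kernel = tensor_sub R.ann"
    using R.ann_ideal act_kernel_eq by blast
  fix P assume P: "S.ring_ideal P \<and> act_kernel = tensor_sub P"
  have nz: "\<exists>x::'g. x \<noteq> 0" using simple unfolding G.simple_def by blast
  have eq: "tensor_sub P = tensor_sub R.ann" using P act_kernel_eq by simp
  show "P = R.ann"
    using tensor_subD[OF _ nz] pure_in_tensor_sub P R.ann_ideal eq by blast
qed

end

section \<open>Radicality from square roots\<close>

context unital_comm_algebra
begin

lemma pow_add: "pow s (m + n) = pow s m * pow s n"
  by (induction m) (simp_all add: pow_def unit_mult mult.assoc)

lemma radical_idealI:
  assumes P: "ring_ideal P" and sq: "\<And>t. t * t \<in> P \<Longrightarrow> t \<in> P"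
  shows "radical_ideal P"
proof -
  have pow1: "pow s 1 = s" for s by (simp add: pow_def mult.commute[of s] unit_mult)
  have "s \<in> P" if "pow s n \<in> P" for s n
    using that
  proof (induction n rule: less_induct)
    case (less n)
    consider "n = 0" | "n = 1" | "n \<ge> 2" by linarith
    thus ?case
    proof cases
      case 1
      hence "s * e \<in> P" using less.prems P by (simp add: pow_def ring_ideal_def)
      thus ?thesis by (simp add: mult.commute[of s] unit_mult)
    next
      case 2
      thus ?thesis using less.prems pow1 by simp
    next
      case 3
      \<comment> \<open>Rounding up gives \<open>2 m \<ge> n\<close>, which puts the power
        \<open>2 m\<close> of \<open>s\<close> into \<open>P\<close>; \<open>n \<ge> 2\<close> still
        leaves \<open>m < n\<close>.\<close>
      define m where "m = Suc n div 2"
      have m: "m < n" "m + m = (m + m - n) + n" using 3 by (auto simp: m_def)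
      have "pow s m * pow s m = pow s (m + m - n) * pow s n"
        using m(2) by (metis pow_add)
      hence "pow s m * pow s m \<in> P" using less.prems P by (simp add: ring_ideal_def)
      thus ?thesis using less.IH[OF m(1)] sq by blast
    qed
  qed
  moreover have "\<exists>n. pow s n \<in> P" if "s \<in> P" for s using that pow1 by metis
  ultimately show ?thesis using P by (auto simp: radical_ideal_def rad_def)
qed

end

theorem proposition4p4:
  fixes scaleG :: "'k::{alg_closed_field, field_char_0} \<Rightarrow> 'g::ab_group_add \<Rightarrow> 'g"
    and br :: "'g \<Rightarrow> 'g \<Rightarrow> 'g"
    and H :: "'g set"
    and scaleS :: "'k \<Rightarrow> 's::comm_ring \<Rightarrow> 's"
    and e :: 's
    and scaleV :: "'k \<Rightarrow> 'v::ab_group_add \<Rightarrow> 'v"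
    and \<phi> :: "('g, 's, 'k) tensor \<Rightarrow> 'v \<Rightarrow> 'v"
  assumes "lie_algebra scaleG br"
    and "fin_dim scaleG UNIV"
    and "lie_algebra.simple scaleG br"
    and "lie_algebra.cartan_subalgebra scaleG br H"
    and "unital_comm_algebra scaleS e"
    and "unital_comm_algebra.finite_type scaleS e"
    and "current_algebra_module scaleG br scaleS e scaleV \<phi>"
    and "current_algebra_module.simple_module scaleG scaleS scaleV \<phi>"
    and "current_algebra_module.admissible scaleG scaleS e scaleV \<phi> H"
  shows "unital_comm_algebra.radical_ideal e
           (current_algebra_module.ideal_of_module scaleG scaleS \<phi>)"
proof -
  interpret M: simple_current_module scaleG br scaleS e scaleV \<phi>
    using assms(2,3,7) by (simp add: simple_current_module_def simple_current_module_axioms_def)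
  have wt: "M.R.wt_space H = M.weight_space H"
    by (simp add: fun_eq_iff M.R.wt_space_def M.weight_space_def)
  have irr: "W = {0} \<or> W = UNIV" if "M.R.invariant W" for W
    using M.submoduleI[OF that] assms(8) by (simp add: M.simple_module_def)
  have "t \<in> M.R.ann" if t: "t * t \<in> M.R.ann" for t
  proof (cases "e \<in> M.R.ann")
    \<comment> \<open>The action is zero, and the annihilator is the unit ideal.\<close>
    case True
    thus ?thesis using M.R.ann_mult[of e t] by (simp add: M.S.unit_mult)
  next
    case False
    obtain B where weight: "M.weight_module H"
      and B: "\<And>l. l \<in> dual_of scaleG H \<Longrightarrow> M.V.dim (M.weight_space H l) \<le> B"
      using assms(9) unfolding M.admissible_def by blast
    interpret W: weight_rep scaleG br scaleS e scaleV "\<lambda>x s. \<phi> (M.pure x s)" H B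
      using assms(4) False irr weight B
      by unfold_locales (simp_all add: wt M.weight_module_def)
    show ?thesis using W.square_in_ann[OF t] .
  qed
  thus ?thesis
    unfolding M.ideal_of_module_eq by (intro M.S.radical_idealI M.R.ann_ideal)
qed

end
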